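(* Let $\mathbb K\in\{\mathbb R,\mathbb C\}$, let $\Omega_{\mathbb K}\subset\mathbb K$, let $K(z,w)$ be a positive definite $\mathbf B(\ell_2(\mathbb N_0))$-valued kernel on $\Omega_{\mathbb K}$ with matrix representation $(k_{nm}(z,w))_{n,m=0}^\infty$ with respect to the standard basis, and let $K(z,w)=\Gamma(z)\Gamma(w)^*$ be a minimal factorization of $K$ via a Hilbert space $\mathcal G$. Let $\mathcal A$ be a topological algebra over $\mathbb K$ with topological dual $\mathcal A'$, both endowed with involutions as described in the context. Then the factorization $$\langle K(z,w)X(b,\mathbf B),X(a,\mathbf A)\rangle_{\ell_2(\mathbb N_0)}=\langle \Gamma(w)^*X(b,\mathbf B),\Gamma(z)^*X(a,\mathbf A)\rangle_{\mathcal G}$$ holds for all $(z,\mathbf A,a),(w,\mathbf B,b)\in\Omega$, and the reproducing kernel Hilbert space of functions on $\Omega$ associated to the positive definite kernel $$\mathcal K\big((z,\mathbf A,a),(w,\mathbf B,b)\big)=\sum_{n,m=0}^\infty\overline{\langle a,A_n^*\rangle}\,k_{nm}(z,w)\,\langle b,B_m^*\rangle$$ consists of the functions of the form $$F(z,\mathbf A,a)=\langle f,\Gamma(z)^*X(a,\mathbf A)\rangle_{\mathcal G},\qquad f\in\mathcal G,$$ with inner product and norm induced from the inner product and the norm of $\mathcal G$ (that is, if $F$ and $G$ correspond in this way to $f,g\in\mathcal G$, then $\langle F,G\rangle=\langle f,g\rangle_{\mathcal G}$).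
   Context: $\ell_2(\mathbb N_0)$ is the Hilbert space of square-summable $\mathbb K$-valued sequences indexed by $\mathbb N_0=\{0,1,2,\dots\}$; inner products are linear in the first variable. $\mathbf B(\mathcal H_1,\mathcal H_2)$ denotes bounded linear operators, $\mathbf B(\mathcal H)=\mathbf B(\mathcal H,\mathcal H)$. An operator-valued function $K:\Omega_{\mathbb K}\times\Omega_{\mathbb K}\to\mathbf B(\ell_2(\mathbb N_0))$ is positive definite if the scalar function $((z,f),(w,e))\mapsto\langle K(z,w)e,f\rangle_{\ell_2(\mathbb N_0)}$ is positive definite (a Hermitian positive semidefinite kernel) on $\Omega_{\mathbb K}\times\ell_2(\mathbb N_0)$. A minimal factorization $K(z,w)=\Gamma(z)\Gamma(w)^*$ via a Hilbert space $\mathcal G$ means that $\Gamma(z)\in\mathbf B(\mathcal G,\ell_2(\mathbb N_0))$ for every $z\in\Omega_{\mathbb K}$ and that the linear span of the ranges of the operators $\Gamma(w)^*$, $w\in\Omega_{\mathbb K}$, is dense in $\mathcal G$. A topological algebra is a (nonzero, unital) algebra over $\mathbb K$ that is a (Hausdorff) locally convex topological vector space in which the product is separately continuous in each variable. $\langle a,A\rangle$ denotes the duality pairing of $a\in\mathcal A'$ and $A\in\mathcal A$. $\mathcal A$ and $\mathcal A'$ carry involutions $A\mapsto A^*$ and $a\mapsto a^*$ that extend complex conjugation, respect the algebraic structure, and satisfy $\overline{\langle a,A\rangle}=\langle a^*,A^*\rangle$. For $a\in\mathcal A'$ and a sequence $\mathbf A=(A_n)_{n=0}^\infty$ of elements of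 $\mathcal A$, $X(a,\mathbf A)$ is the column $(\langle a,A_n^*\rangle)_{n=0}^\infty$. The set $\Omega$ consists of all triples $(z,\mathbf A,a)$ with $z\in\Omega_{\mathbb K}$ and $X(a,\mathbf A)\in\ell_2(\mathbb N_0)$. *)

theory Defs
  imports "HOL-Analysis.Analysis" "HOL-Library.Function_Algebras"
begin

section \<open>The scalar field\<close>

text \<open>
  The class has exactly two models up to isomorphism, the real field with the identity as
  conjugation and the complex field with complex conjugation (see the two instances and the
  lemma \<open>real_or_complex_cases\<close>). A type variable of this class thus plays the role of a field
  that is either \<open>\<real>\<close> or \<open>\<complex>\<close>.
\<close>

class real_or_complex = real_normed_field +
  fixes kconj :: "'a \<Rightarrow> 'a"
  assumes kconj_add: "kconj (x + y) = kconj x + kconj y"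
    and kconj_mult: "kconj (x * y) = kconj x * kconj y"
    and kconj_kconj: "kconj (kconj x) = x"
    and kconj_scaleR_one: "kconj (r *\<^sub>R 1) = r *\<^sub>R 1"
    and mult_kconj_scaleR: "x * kconj x = (norm x)\<^sup>2 *\<^sub>R 1"

instantiation real :: real_or_complex
begin
definition kconj_real :: "real \<Rightarrow> real" where "kconj_real x = x"
instance by standard (simp_all add: kconj_real_def power2_eq_square)
end

instantiation complex :: real_or_complex
begin
definition kconj_complex :: "complex \<Rightarrow> complex" where "kconj_complex = cnj"
instance
  by standard (simp_all add: kconj_complex_def complex_mult_cnj cmod_power2 scaleR_conv_of_real)
end

lemma kconj_of_real: "kconj (of_real r :: 'k::real_or_complex) = of_real r"
  by (simp add: of_real_def kconj_scaleR_one)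

lemma mult_kconj: "x * kconj x = (of_real ((norm x)\<^sup>2) :: 'k::real_or_complex)"
  by (simp add: of_real_def mult_kconj_scaleR)

lemma kconj_fixed_imp_real:
  fixes x :: "'k::real_or_complex"
  assumes "kconj x = x"
  shows "\<exists>r. x = of_real r"
proof -
  have "x\<^sup>2 = (of_real (norm x))\<^sup>2"
    using mult_kconj[of x] assms by (simp add: power2_eq_square)
  then have "x = of_real (norm x) \<or> x = - of_real (norm x)"
    by (simp add: power2_eq_iff)
  then show ?thesis
    by (metis of_real_minus)
qed

lemma real_or_complex_cases:
  "(\<forall>x::'k::real_or_complex. kconj x = x \<and> (\<exists>r. x = of_real r)) \<or>
   (\<exists>i::'k. i * i = - 1 \<and> kconj i = - i \<and> (\<forall>x. \<exists>a b. x = of_real a + i * of_real b))"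
proof (cases "\<forall>x::'k. kconj x = x")
  case True
  then show ?thesis using kconj_fixed_imp_real by blast
next
  case False
  have zero: "kconj (0::'k) = 0" using kconj_of_real[of 0] by simp
  have minus: "kconj (- x) = - kconj x" for x :: 'k
    using kconj_add[of x "- x"] zero by (simp add: add_eq_0_iff)
  have diff: "kconj (x - y) = kconj x - kconj y" for x y :: 'k
    using kconj_add[of x "- y"] minus by simp
  from False obtain y :: 'k where y: "kconj y \<noteq> y" by blast
  define d where "d = y - kconj y"
  have d0: "d \<noteq> 0" and dc: "kconj d = - d"
    using y by (auto simp: d_def diff kconj_kconj)
  define i where "i = d * of_real (inverse (norm d))"
  have dd: "d * d = - of_real ((norm d)\<^sup>2)"
    using mult_kconj[of d] dc by (metis minus_minus mult_minus_right)
  have "i * i = (d * d) * of_real (inverse (norm d) * inverse (norm d))"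
    by (simp add: i_def ac_simps)
  also have "\<dots> = - of_real ((norm d)\<^sup>2 * (inverse (norm d) * inverse (norm d)))"
    unfolding dd by simp
  also have "(norm d)\<^sup>2 * (inverse (norm d) * inverse (norm d)) = 1"
    using d0 by (simp add: power2_eq_square field_simps)
  finally have ii: "i * i = - 1" by simp
  have ic: "kconj i = - i"
    unfolding i_def kconj_mult kconj_of_real dc by simp
  have "\<exists>a b. x = of_real a + i * of_real b" for x :: 'k
  proof -
    define u where "u = (x + kconj x) * of_real (1/2)"
    define v where "v = (x - kconj x) * of_real (1/2)"
    have "kconj u = u"
      unfolding u_def kconj_mult kconj_add kconj_kconj kconj_of_real by (simp add: add.commute)
    then obtain a where a: "u = of_real a" using kconj_fixed_imp_real by blast
    have vc: "kconj v = - v"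
      unfolding v_def kconj_mult diff kconj_kconj kconj_of_real by (simp add: field_simps)
    have "kconj (- (i * v)) = - (i * v)"
      by (simp add: minus kconj_mult ic vc)
    then obtain b where b: "- (i * v) = of_real b" using kconj_fixed_imp_real by blast
    have "i * of_real b = - (i * i) * v" by (simp flip: b add: mult.assoc)
    then have v: "v = i * of_real b" by (simp add: ii)
    have "x = u + v" by (simp add: u_def v_def field_simps)
    then show ?thesis using a v by blast
  qed
  then show ?thesis using ii ic by blast
qed


section \<open>Hilbert spaces and bounded operators\<close>

text \<open>
  Inner product spaces are carried by a linear subspace \<open>H\<close> of an ambient vector space; nothing
  is required of \<open>ip\<close> outside \<open>H\<close>. This allows \<open>\<ell>\<^sub>2\<close> and reproducing kernel Hilbert spaces, whose
  vectors are functions, to be treated by the same notion as abstract Hilbert spaces.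
\<close>

locale inner_product_space_on = vector_space scale
  for scale :: "'k::real_or_complex \<Rightarrow> 'v::ab_group_add \<Rightarrow> 'v" +
  fixes H :: "'v set" and ip :: "'v \<Rightarrow> 'v \<Rightarrow> 'k"
  assumes subspace_H: "subspace H"
    and ip_add_left: "\<lbrakk>x \<in> H; y \<in> H; z \<in> H\<rbrakk> \<Longrightarrow> ip (x + y) z = ip x z + ip y z"
    and ip_scale_left: "\<lbrakk>x \<in> H; y \<in> H\<rbrakk> \<Longrightarrow> ip (scale c x) y = c * ip x y"
    and ip_hermitian: "\<lbrakk>x \<in> H; y \<in> H\<rbrakk> \<Longrightarrow> ip y x = kconj (ip x y)"
    and ip_nonneg: "x \<in> H \<Longrightarrow> \<exists>r\<ge>0. ip x x = of_real r"
    and ip_definite: "\<lbrakk>x \<in> H; ip x x = 0\<rbrakk> \<Longrightarrow> x = 0"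

text \<open>Since \<open>ip x x\<close> is a nonnegative real scalar, its absolute value is the scalar itself.\<close>

definition ip_norm :: "('v \<Rightarrow> 'v \<Rightarrow> 'k::real_or_complex) \<Rightarrow> 'v \<Rightarrow> real" where
  "ip_norm ip x = sqrt (norm (ip x x))"

locale hilbert_space_on = inner_product_space_on +
  assumes complete_H:
    "\<lbrakk>\<And>n::nat. X n \<in> H;
      \<And>e. 0 < e \<Longrightarrow> \<exists>N. \<forall>m\<ge>N. \<forall>n\<ge>N. ip_norm ip (X m - X n) < e\<rbrakk>
     \<Longrightarrow> \<exists>L\<in>H. (\<lambda>n. ip_norm ip (X n - L)) \<longlonglongrightarrow> 0"

definition bounded_operator_on ::
  "('k::real_or_complex \<Rightarrow> 'v::ab_group_add \<Rightarrow> 'v) \<Rightarrow> 'v set \<Rightarrow> ('v \<Rightarrow> 'v \<Rightarrow> 'k) \<Rightarrow>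
   ('k \<Rightarrow> 'w::ab_group_add \<Rightarrow> 'w) \<Rightarrow> 'w set \<Rightarrow> ('w \<Rightarrow> 'w \<Rightarrow> 'k) \<Rightarrow> ('v \<Rightarrow> 'w) \<Rightarrow> bool" where
  "bounded_operator_on scaleV V ipV scaleW W ipW T \<longleftrightarrow>
     (\<forall>x\<in>V. T x \<in> W) \<and>
     (\<forall>x\<in>V. \<forall>y\<in>V. T (x + y) = T x + T y) \<and>
     (\<forall>c. \<forall>x\<in>V. T (scaleV c x) = scaleW c (T x)) \<and>
     (\<exists>C. \<forall>x\<in>V. ip_norm ipW (T x) \<le> C * ip_norm ipV x)"

text \<open>The adjoint of \<open>T\<close> from \<open>(V, ipV)\<close> to a space with inner product \<open>ipW\<close>.\<close>

definition adjoint_on ::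
  "'v set \<Rightarrow> ('v \<Rightarrow> 'v \<Rightarrow> 'k) \<Rightarrow> ('w \<Rightarrow> 'w \<Rightarrow> 'k) \<Rightarrow> ('v \<Rightarrow> 'w) \<Rightarrow> 'w \<Rightarrow> 'v" where
  "adjoint_on V ipV ipW T y = (THE x. x \<in> V \<and> (\<forall>u\<in>V. ipW (T u) y = ipV u x))"

definition dense_on :: "'v set \<Rightarrow> ('v::ab_group_add \<Rightarrow> 'v \<Rightarrow> 'k::real_or_complex) \<Rightarrow> 'v set \<Rightarrow> bool"
  where "dense_on H ip S \<longleftrightarrow> S \<subseteq> H \<and> (\<forall>x\<in>H. \<forall>e>0. \<exists>s\<in>S. ip_norm ip (x - s) < e)"

definition fun_scale :: "'k::times \<Rightarrow> ('x \<Rightarrow> 'k) \<Rightarrow> 'x \<Rightarrow> 'k" where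
  "fun_scale c f = (\<lambda>x. c * f x)"


section \<open>Square-summable sequences\<close>

definition ell2 :: "(nat \<Rightarrow> 'k::real_or_complex) set" where
  "ell2 = {x. summable (\<lambda>n. (norm (x n))\<^sup>2)}"

definition ell2_ip :: "(nat \<Rightarrow> 'k::real_or_complex) \<Rightarrow> (nat \<Rightarrow> 'k) \<Rightarrow> 'k" where
  "ell2_ip x y = (\<Sum>n. x n * kconj (y n))"

definition std_basis :: "nat \<Rightarrow> nat \<Rightarrow> 'k::real_or_complex" where
  "std_basis m = (\<lambda>n. if n = m then 1 else 0)"

definition matrix_entry ::
  "((nat \<Rightarrow> 'k) \<Rightarrow> nat \<Rightarrow> 'k::real_or_complex) \<Rightarrow> nat \<Rightarrow> nat \<Rightarrow> 'k" where
  "matrix_entry T n m = ell2_ip (T (std_basis m)) (std_basis n)"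

abbreviation ell2_bounded_operator ::
  "((nat \<Rightarrow> 'k::real_or_complex) \<Rightarrow> nat \<Rightarrow> 'k) \<Rightarrow> bool" where
  "ell2_bounded_operator \<equiv> bounded_operator_on fun_scale ell2 ell2_ip fun_scale ell2 ell2_ip"


section \<open>Positive definite kernels and reproducing kernel Hilbert spaces\<close>

definition pd_kernel :: "'x set \<Rightarrow> ('x \<Rightarrow> 'x \<Rightarrow> 'k::real_or_complex) \<Rightarrow> bool" where
  "pd_kernel X k \<longleftrightarrow>
     (\<forall>x\<in>X. \<forall>y\<in>X. k y x = kconj (k x y)) \<and>
     (\<forall>(N::nat) x c. (\<forall>i<N. x i \<in> X) \<longrightarrow>
        (\<exists>r\<ge>0. (\<Sum>i<N. \<Sum>j<N. kconj (c i) * k (x i) (x j) * c j) = of_real r))"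

definition pd_operator_kernel ::
  "'z set \<Rightarrow> ('z \<Rightarrow> 'z \<Rightarrow> (nat \<Rightarrow> 'k) \<Rightarrow> nat \<Rightarrow> 'k::real_or_complex) \<Rightarrow> bool" where
  "pd_operator_kernel Z K \<longleftrightarrow>
     (\<forall>z\<in>Z. \<forall>w\<in>Z. ell2_bounded_operator (K z w)) \<and>
     pd_kernel (Z \<times> ell2) (\<lambda>(z, f) (w, e). ell2_ip (K z w e) f)"

definition minimal_factorization ::
  "'z set \<Rightarrow> ('z \<Rightarrow> 'z \<Rightarrow> (nat \<Rightarrow> 'k) \<Rightarrow> nat \<Rightarrow> 'k::real_or_complex) \<Rightarrow>
   ('k \<Rightarrow> 'g::ab_group_add \<Rightarrow> 'g) \<Rightarrow> 'g set \<Rightarrow> ('g \<Rightarrow> 'g \<Rightarrow> 'k) \<Rightarrow> ('z \<Rightarrow> 'g \<Rightarrow> nat \<Rightarrow> 'k) \<Rightarrow> bool"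
  where
  "minimal_factorization Z K scaleG G ipG \<Gamma> \<longleftrightarrow>
     hilbert_space_on scaleG G ipG \<and>
     (\<forall>z\<in>Z. bounded_operator_on scaleG G ipG fun_scale ell2 ell2_ip (\<Gamma> z)) \<and>
     (\<forall>z\<in>Z. \<forall>w\<in>Z. \<forall>x\<in>ell2. K z w x = \<Gamma> z (adjoint_on G ipG ell2_ip (\<Gamma> w) x)) \<and>
     dense_on G ipG (module.span scaleG (\<Union>w\<in>Z. adjoint_on G ipG ell2_ip (\<Gamma> w) ` ell2))"

text \<open>
  \<open>(H, ip)\<close> is the reproducing kernel Hilbert space of functions on \<open>X\<close> with kernel \<open>k\<close>. A
  function on the set \<open>X\<close> is represented by its extension by zero to the whole type.
\<close>

definition is_rkhs ::
  "'x set \<Rightarrow> ('x \<Rightarrow> 'x \<Rightarrow> 'k) \<Rightarrow> ('x \<Rightarrow> 'k::real_or_complex) set \<Rightarrow>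
   (('x \<Rightarrow> 'k) \<Rightarrow> ('x \<Rightarrow> 'k) \<Rightarrow> 'k) \<Rightarrow> bool" where
  "is_rkhs X k H ip \<longleftrightarrow>
     hilbert_space_on fun_scale H ip \<and>
     (\<forall>F\<in>H. \<forall>x. x \<notin> X \<longrightarrow> F x = 0) \<and>
     (\<forall>y\<in>X. (\<lambda>x. if x \<in> X then k x y else 0) \<in> H \<and>
        (\<forall>F\<in>H. F y = ip F (\<lambda>x. if x \<in> X then k x y else 0)))"


section \<open>Topological algebras with involution\<close>

text \<open>
  The type classes supply the ring structure with \<open>0 \<noteq> 1\<close>, continuity of addition and negation,
  and the Hausdorff property.
\<close>

locale topological_algebra = vector_space scale
  for scale ::
    "'k::real_or_complex \<Rightarrow> 'a::{ring_1, topological_ab_group_add, t2_space} \<Rightarrow> 'a" +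
  assumes scale_mult_left: "scale c x * y = scale c (x * y)"
    and scale_mult_right: "x * scale c y = scale c (x * y)"
    and continuous_scale: "continuous_on UNIV (\<lambda>(c, x). scale c x)"
    and locally_convex: "\<lbrakk>open U; 0 \<in> U\<rbrakk> \<Longrightarrow>
      \<exists>V. open V \<and> 0 \<in> V \<and> V \<subseteq> U \<and>
        (\<forall>x\<in>V. \<forall>y\<in>V. \<forall>t::real. 0 \<le> t \<and> t \<le> 1 \<longrightarrow>
           scale (of_real (1 - t)) x + scale (of_real t) y \<in> V)"
    and continuous_mult_left: "continuous_on UNIV (\<lambda>x. x * y)"
    and continuous_mult_right: "continuous_on UNIV (\<lambda>x. y * x)"

definition topological_dual ::
  "('k::real_or_complex \<Rightarrow> 'a::{ab_group_add, topological_space} \<Rightarrow> 'a) \<Rightarrow> ('a \<Rightarrow> 'k) set" where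
  "topological_dual scaleA = {a. Vector_Spaces.linear scaleA (*) a \<and> continuous_on UNIV a}"

text \<open>
  The pairing of \<open>a\<close> in the dual with \<open>A\<close> is the value \<open>a A\<close>. Both usual conventions for the
  behaviour of an involution on products (order reversing or order preserving) are admitted.
\<close>

locale topological_algebra_with_involutions = topological_algebra scale
  for scale ::
    "'k::real_or_complex \<Rightarrow> 'a::{ring_1, topological_ab_group_add, t2_space} \<Rightarrow> 'a" +
  fixes star :: "'a \<Rightarrow> 'a" and dual_star :: "('a \<Rightarrow> 'k) \<Rightarrow> 'a \<Rightarrow> 'k"
  assumes star_star: "star (star x) = x"
    and star_add: "star (x + y) = star x + star y"
    and star_scale: "star (scale c x) = scale (kconj c) (star x)"
    and star_one: "star 1 = 1"
    and star_mult: "(\<forall>x y. star (x * y) = star y * star x) \<or>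
                    (\<forall>x y. star (x * y) = star x * star y)"
    and dual_star_closed: "a \<in> topological_dual scale \<Longrightarrow> dual_star a \<in> topological_dual scale"
    and dual_star_star: "a \<in> topological_dual scale \<Longrightarrow> dual_star (dual_star a) = a"
    and dual_star_add: "\<lbrakk>a \<in> topological_dual scale; b \<in> topological_dual scale\<rbrakk> \<Longrightarrow>
      dual_star (a + b) = dual_star a + dual_star b"
    and dual_star_scale: "a \<in> topological_dual scale \<Longrightarrow>
      dual_star (fun_scale c a) = fun_scale (kconj c) (dual_star a)"
    and kconj_pairing: "a \<in> topological_dual scale \<Longrightarrow> kconj (a x) = dual_star a (star x)"


section \<open>The kernel on triples\<close>

definition pairing_column :: "('a \<Rightarrow> 'a) \<Rightarrow> ('a \<Rightarrow> 'k) \<Rightarrow> (nat \<Rightarrow> 'a) \<Rightarrow> nat \<Rightarrow> 'k" where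
  "pairing_column star a A = (\<lambda>n. a (star (A n)))"

definition triples ::
  "'k set \<Rightarrow> ('k::real_or_complex \<Rightarrow> 'a::{ab_group_add, topological_space} \<Rightarrow> 'a) \<Rightarrow>
   ('a \<Rightarrow> 'a) \<Rightarrow> ('k \<times> (nat \<Rightarrow> 'a) \<times> ('a \<Rightarrow> 'k)) set" where
  "triples Z scaleA star =
     {(z, A, a). z \<in> Z \<and> a \<in> topological_dual scaleA \<and> pairing_column star a A \<in> ell2}"

text \<open>
  Double series are understood as limits of rectangular partial sums with both upper bounds
  tending to infinity independently. For the matrix of a bounded operator on \<open>\<ell>\<^sub>2\<close> the double
  series below need not converge absolutely, so unordered summation would be inappropriate.
\<close>

definition double_partial_sum ::
  "(nat \<Rightarrow> nat \<Rightarrow> 'k::real_or_complex) \<Rightarrow> nat \<times> nat \<Rightarrow> 'k" where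
  "double_partial_sum s = (\<lambda>(N, M). \<Sum>n<N. \<Sum>m<M. s n m)"

definition double_summable :: "(nat \<Rightarrow> nat \<Rightarrow> 'k::real_or_complex) \<Rightarrow> bool" where
  "double_summable s \<longleftrightarrow> (\<exists>l. (double_partial_sum s \<longlongrightarrow> l) (sequentially \<times>\<^sub>F sequentially))"

definition double_suminf :: "(nat \<Rightarrow> nat \<Rightarrow> 'k::real_or_complex) \<Rightarrow> 'k" where
  "double_suminf s = Lim (sequentially \<times>\<^sub>F sequentially) (double_partial_sum s)"

definition triple_kernel_term ::
  "('k \<Rightarrow> 'k \<Rightarrow> (nat \<Rightarrow> 'k) \<Rightarrow> nat \<Rightarrow> 'k) \<Rightarrow> ('a \<Rightarrow> 'a) \<Rightarrow>
   'k \<times> (nat \<Rightarrow> 'a) \<times> ('a \<Rightarrow> 'k) \<Rightarrow> 'k \<times> (nat \<Rightarrow> 'a) \<times> ('a \<Rightarrow> 'k) \<Rightarrow>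
   nat \<Rightarrow> nat \<Rightarrow> 'k::real_or_complex" where
  "triple_kernel_term K star = (\<lambda>(z, A, a) (w, B, b) n m.
     kconj (a (star (A n))) * matrix_entry (K z w) n m * b (star (B m)))"

definition triple_kernel ::
  "('k \<Rightarrow> 'k \<Rightarrow> (nat \<Rightarrow> 'k) \<Rightarrow> nat \<Rightarrow> 'k) \<Rightarrow> ('a \<Rightarrow> 'a) \<Rightarrow>
   'k \<times> (nat \<Rightarrow> 'a) \<times> ('a \<Rightarrow> 'k) \<Rightarrow> 'k \<times> (nat \<Rightarrow> 'a) \<times> ('a \<Rightarrow> 'k) \<Rightarrow> 'k::real_or_complex" where
  "triple_kernel K star p q = double_suminf (triple_kernel_term K star p q)"

text \<open>The function on \<open>\<Omega>\<close> (extended by zero) that corresponds to the vector \<open>f\<close>.\<close>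

definition factor_function ::
  "('k \<times> (nat \<Rightarrow> 'a) \<times> ('a \<Rightarrow> 'k)) set \<Rightarrow> ('a \<Rightarrow> 'a) \<Rightarrow> 'g set \<Rightarrow> ('g \<Rightarrow> 'g \<Rightarrow> 'k) \<Rightarrow>
   ('k \<Rightarrow> 'g \<Rightarrow> nat \<Rightarrow> 'k) \<Rightarrow> 'g \<Rightarrow> 'k \<times> (nat \<Rightarrow> 'a) \<times> ('a \<Rightarrow> 'k) \<Rightarrow> 'k::real_or_complex" where
  "factor_function \<Omega> star G ipG \<Gamma> f = (\<lambda>(z, A, a).
     if (z, A, a) \<in> \<Omega>
     then ipG f (adjoint_on G ipG ell2_ip (\<Gamma> z) (pairing_column star a A))
     else 0)"

end

theory Submission
  imports Defs
begin

text \<open>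
  Put \<open>\<phi> (z, A, a) = \<Gamma>(z)\<^sup>* X(a, A)\<close>. Since \<open>K(z, w) = \<Gamma>(z) \<Gamma>(w)\<^sup>*\<close>, the kernel on triples is the Gram kernel
  \<open>\<langle>\<phi> q, \<phi> p\<rangle>\<close> of these vectors of \<open>G\<close>; that is the factorization. For a Gram kernel of vectors with
  dense span, the map sending \<open>f\<close> to the function \<open>p \<mapsto> \<langle>f, \<phi> p\<rangle>\<close> is an isometry of \<open>G\<close> onto the
  reproducing kernel Hilbert space (\<open>rkhs_exists\<close> and \<open>rkhs_unique\<close> in the locale \<open>feature_map\<close>). Three
  points need work.

  The adjoints \<open>\<Gamma>(z)\<^sup>*\<close> exist by the Riesz representation theorem, which is also the tool that identifies
  every element of a reproducing kernel Hilbert space with a vector of \<open>G\<close>.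

  The double series of the matrix entries converges to \<open>\<langle>K(z, w) X(b, B), X(a, A)\<rangle>\<close> because its rectangular
  partial sums are the values of this form at truncated columns (\<open>double_partial_sum_tendsto\<close>). Positive
  definiteness is then inherited from \<open>K\<close>.

  The vectors \<open>\<phi> p\<close> have dense span because every sequence in \<open>\<ell>\<^sub>2\<close> is a column \<open>X(a, A)\<close>, so that they
  exhaust the ranges of the operators \<open>\<Gamma>(z)\<^sup>*\<close> and minimality applies. This needs a continuous functional
  that does not vanish at the unit of the algebra, and here local convexity and the Hausdorff property
  enter through the Hahn-Banach theorem (\<open>topological_dual_separates\<close>). Its sublinear form is derived from
  Zorn's lemma by showing that minimal sublinear functionals are linear.
\<close>

section \<open>The scalar field\<close>

lemma kconj_zero [simp]: "kconj (0::'k::real_or_complex) = 0"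
  using kconj_of_real[of 0] by simp

lemma kconj_one [simp]: "kconj (1::'k::real_or_complex) = 1"
  using kconj_of_real[of 1] by simp

lemma kconj_scaleR: "kconj (r *\<^sub>R x :: 'k::real_or_complex) = r *\<^sub>R kconj x"
  by (metis kconj_mult kconj_of_real scaleR_conv_of_real)

lemma norm_kconj [simp]: "norm (kconj (x::'k::real_or_complex)) = norm x"
proof (cases "x = 0")
  case False
  have "norm x * norm (kconj x) = (norm x)\<^sup>2"
    using arg_cong[OF mult_kconj[of x], of norm] by (simp add: norm_mult del: of_real_power)
  then show ?thesis using False by (simp add: power2_eq_square)
qed simp

lemma bounded_linear_kconj: "bounded_linear (kconj :: 'k::real_or_complex \<Rightarrow> 'k)"
  by (rule bounded_linear_intro[where K = 1]) (auto simp: kconj_add kconj_scaleR)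

lemmas kconj_minus [simp] = linear_neg[OF bounded_linear.linear[OF bounded_linear_kconj]]

text \<open>
  Completeness of the scalars makes absolutely convergent series in them convergent, which is
  what the inner product of \<open>\<ell>\<^sub>2\<close> rests on. It reduces to the completeness of \<open>\<real>\<close>, because real
  and imaginary part are bounded linear functions of the scalar.
\<close>

instance real_or_complex \<subseteq> banach
proof
  fix X :: "nat \<Rightarrow> 'a"
  assume X: "Cauchy X"
  have conv: "convergent Y" if Y: "\<And>n. Y n = of_real (r n)" "Cauchy Y" for Y :: "nat \<Rightarrow> 'a" and r
  proof -
    have "dist (r m) (r n) = dist (Y m) (Y n)" for m n
      by (simp add: Y(1) dist_norm flip: of_real_diff)
    then have "Cauchy r" using Y(2) by (simp add: Cauchy_def)
    then obtain l where "r \<longlonglongrightarrow> l"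
      using Cauchy_convergent convergent_def by blast
    then have "Y \<longlonglongrightarrow> of_real l"
      unfolding Y(1)[abs_def] by (rule tendsto_of_real)
    then show ?thesis by (auto simp: convergent_def)
  qed
  consider "\<forall>x::'a. kconj x = x \<and> (\<exists>r. x = of_real r)" |
    i where "i * i = - 1" "kconj i = - i" "\<forall>x::'a. \<exists>a b. x = of_real a + i * of_real b"
    using real_or_complex_cases by blast
  then show "convergent X"
  proof cases
    case 1
    then have "\<forall>n. \<exists>r. X n = of_real r" by blast
    then obtain r where "\<And>n. X n = of_real (r n)" by metis
    with X show ?thesis using conv by blast
  next
    case 2
    then have "\<forall>n. \<exists>a b. X n = of_real a + i * of_real b" by blast
    then obtain a b where ab: "\<And>n. X n = of_real (a n) + i * of_real (b n)" by metis
    \<comment> \<open>The coordinates are written through conjugation, since no real part is given on this class.\<close>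
    have re: "of_real (a n) = (X n + kconj (X n)) * of_real (1/2)" for n
      by (simp add: ab kconj_add kconj_mult kconj_of_real 2)
    have im: "of_real (b n) = - i * (X n - kconj (X n)) * of_real (1/2)" for n
    proof -
      have "X n - kconj (X n) = of_real 2 * i * of_real (b n)"
        by (simp add: ab kconj_add kconj_mult kconj_of_real 2(2))
      then have "- i * (X n - kconj (X n)) * of_real (1/2) = - (i * i) * of_real (b n)"
        by simp
      then show ?thesis by (simp add: 2(1))
    qed
    have "bounded_linear (\<lambda>x::'a. (x + kconj x) * of_real (1/2))"
      by (rule bounded_linear_compose[OF bounded_linear_mult_left
            bounded_linear_add[OF bounded_linear_ident bounded_linear_kconj]])
    then have "Cauchy (\<lambda>n. of_real (a n) :: 'a)"
      unfolding re using X by (rule bounded_linear.Cauchy)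
    moreover have "bounded_linear (\<lambda>x::'a. - i * (x - kconj x) * of_real (1/2))"
      by (rule bounded_linear_compose[OF bounded_linear_mult_left bounded_linear_compose[OF
            bounded_linear_mult_right bounded_linear_sub[OF bounded_linear_ident bounded_linear_kconj]]])
    then have "Cauchy (\<lambda>n. of_real (b n) :: 'a)"
      unfolding im using X by (rule bounded_linear.Cauchy)
    ultimately have "convergent (\<lambda>n. of_real (a n) :: 'a)" "convergent (\<lambda>n. of_real (b n) :: 'a)"
      using conv[of "\<lambda>n. of_real (a n)" a] conv[of "\<lambda>n. of_real (b n)" b] by simp_all
    then obtain l m :: 'a where "(\<lambda>n. of_real (a n)) \<longlonglongrightarrow> l" "(\<lambda>n. of_real (b n)) \<longlonglongrightarrow> m"
      by (auto simp: convergent_def)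
    then have "X \<longlonglongrightarrow> l + i * m"
      unfolding ab[abs_def] by (intro tendsto_intros)
    then show ?thesis by (auto simp: convergent_def)
  qed
qed

section \<open>Inner product spaces and the Riesz representation theorem\<close>

lemma vector_space_fun_scale: "vector_space (fun_scale :: 'k::field \<Rightarrow> ('x \<Rightarrow> 'k) \<Rightarrow> 'x \<Rightarrow> 'k)"
  by unfold_locales (auto simp: fun_scale_def fun_eq_iff algebra_simps)

context inner_product_space_on
begin

lemma ip_add_right: "\<lbrakk>x \<in> H; y \<in> H; z \<in> H\<rbrakk> \<Longrightarrow> ip z (x + y) = ip z x + ip z y"
  by (metis ip_add_left ip_hermitian kconj_add subspace_H subspace_add)

lemma ip_scale_right: "\<lbrakk>x \<in> H; y \<in> H\<rbrakk> \<Longrightarrow> ip y (scale c x) = kconj c * ip y x"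
  by (metis ip_scale_left ip_hermitian kconj_mult subspace_H subspace_scale)

lemma ip_minus_left: "\<lbrakk>x \<in> H; y \<in> H\<rbrakk> \<Longrightarrow> ip (- x) y = - ip x y"
  using ip_scale_left[of x y "- 1"] by simp

lemma ip_minus_right: "\<lbrakk>x \<in> H; y \<in> H\<rbrakk> \<Longrightarrow> ip y (- x) = - ip y x"
  using ip_scale_right[of x y "- 1"] by simp

lemma ip_diff_left: "\<lbrakk>x \<in> H; y \<in> H; z \<in> H\<rbrakk> \<Longrightarrow> ip (x - y) z = ip x z - ip y z"
  using ip_add_left[of x "- y" z] by (simp add: ip_minus_left subspace_neg subspace_H)

lemma ip_diff_right: "\<lbrakk>x \<in> H; y \<in> H; z \<in> H\<rbrakk> \<Longrightarrow> ip z (x - y) = ip z x - ip z y"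
  using ip_add_right[of x "- y" z] by (simp add: ip_minus_right subspace_neg subspace_H)

lemma ip_zero_left [simp]: "x \<in> H \<Longrightarrow> ip 0 x = 0"
  using ip_scale_left[of x x 0] by simp

lemma ip_zero_right [simp]: "x \<in> H \<Longrightarrow> ip x 0 = 0"
  using ip_scale_right[of x x 0] by simp

lemmas H_closed = subspace_0[OF subspace_H] subspace_add[OF subspace_H]
  subspace_diff[OF subspace_H] subspace_scale[OF subspace_H] subspace_neg[OF subspace_H]

lemmas ip_bilinear = ip_add_left ip_add_right ip_diff_left ip_diff_right
  ip_scale_left ip_scale_right

lemma ip_self: "x \<in> H \<Longrightarrow> ip x x = of_real ((ip_norm ip x)\<^sup>2)"
  using ip_nonneg[of x] by (auto simp: ip_norm_def)

lemma ip_norm_nonneg [simp]: "0 \<le> ip_norm ip x"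
  by (simp add: ip_norm_def)

lemma ip_norm_eq_0: "x \<in> H \<Longrightarrow> ip_norm ip x = 0 \<longleftrightarrow> x = 0"
  by (metis ip_definite ip_norm_def ip_zero_left norm_zero real_sqrt_zero norm_eq_zero real_sqrt_eq_zero_cancel_iff)

lemma ip_norm_scale: "x \<in> H \<Longrightarrow> ip_norm ip (scale c x) = norm c * ip_norm ip x"
  by (simp add: ip_norm_def ip_bilinear H_closed norm_mult real_sqrt_mult)

lemma ip_norm_minus_commute: "\<lbrakk>x \<in> H; y \<in> H\<rbrakk> \<Longrightarrow> ip_norm ip (x - y) = ip_norm ip (y - x)"
  using ip_norm_scale[of "y - x" "- 1"] H_closed by simp

lemma Cauchy_Schwarz:
  assumes x: "x \<in> H" and y: "y \<in> H"
  shows "norm (ip x y) \<le> ip_norm ip x * ip_norm ip y"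
proof (cases "ip_norm ip y = 0")
  case True
  then show ?thesis using x y by (simp add: ip_norm_eq_0)
next
  case False
  let ?a = "ip_norm ip x" and ?b = "ip_norm ip y" and ?c = "norm (ip x y)"
  define z where "z = scale (of_real (?b\<^sup>2)) x - scale (ip x y) y"
  have z: "z \<in> H" using x y by (simp add: z_def H_closed)
  have "ip z z = of_real (?b\<^sup>2) * (of_real (?a\<^sup>2 * ?b\<^sup>2) - ip x y * kconj (ip x y))"
    using x y unfolding z_def
    by (simp add: ip_bilinear H_closed ip_self[OF x] ip_self[OF y] ip_hermitian[OF x y] kconj_of_real algebra_simps
        del: of_real_power)
  also have "\<dots> = of_real (?b\<^sup>2 * (?a\<^sup>2 * ?b\<^sup>2 - ?c\<^sup>2))"
    by (simp add: mult_kconj)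
  finally have "(ip_norm ip z)\<^sup>2 = ?b\<^sup>2 * (?a\<^sup>2 * ?b\<^sup>2 - ?c\<^sup>2)"
    unfolding ip_self[OF z] of_real_eq_iff .
  then have "0 \<le> ?b\<^sup>2 * (?a\<^sup>2 * ?b\<^sup>2 - ?c\<^sup>2)"
    by (metis zero_le_power2)
  then have "?c\<^sup>2 \<le> (?a * ?b)\<^sup>2"
    using False by (simp add: zero_le_mult_iff power_mult_distrib)
  then show ?thesis
    by (rule power2_le_imp_le) simp
qed

lemma ip_norm_triangle:
  assumes x: "x \<in> H" and y: "y \<in> H"
  shows "ip_norm ip (x + y) \<le> ip_norm ip x + ip_norm ip y"
proof (rule power2_le_imp_le)
  let ?a = "ip_norm ip x" and ?b = "ip_norm ip y"
  have "(ip_norm ip (x + y))\<^sup>2 = norm (ip x x + ip x y + ip y x + ip y y)"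
    using x y by (simp add: ip_norm_def ip_bilinear H_closed algebra_simps)
  also have "\<dots> \<le> norm (ip x x) + norm (ip x y) + norm (ip y x) + norm (ip y y)"
    by (intro order_trans[OF norm_triangle_ineq] add_mono order_refl)
  also have "\<dots> \<le> ?a * ?a + ?a * ?b + ?b * ?a + ?b * ?b"
    using x y by (intro add_mono Cauchy_Schwarz)
  also have "\<dots> = (?a + ?b)\<^sup>2" by (simp add: power2_eq_square algebra_simps)
  finally show "(ip_norm ip (x + y))\<^sup>2 \<le> (?a + ?b)\<^sup>2" .
qed simp

lemma ip_norm_triangle_diff:
  assumes "x \<in> H" "y \<in> H" "z \<in> H"
  shows "ip_norm ip (x - z) \<le> ip_norm ip (x - y) + ip_norm ip (y - z)"
  using ip_norm_triangle[of "x - y" "y - z"] assms by (simp add: H_closed)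

lemma parallelogram:
  assumes x: "x \<in> H" and y: "y \<in> H"
  shows "(ip_norm ip (x - y))\<^sup>2 = 2 * (ip_norm ip x)\<^sup>2 + 2 * (ip_norm ip y)\<^sup>2 - (ip_norm ip (x + y))\<^sup>2"
proof -
  have "ip (x - y) (x - y) = 2 * ip x x + 2 * ip y y - ip (x + y) (x + y)"
    using x y by (simp add: ip_bilinear H_closed)
  also have "\<dots> = of_real (2 * (ip_norm ip x)\<^sup>2 + 2 * (ip_norm ip y)\<^sup>2 - (ip_norm ip (x + y))\<^sup>2)"
    using x y by (simp add: ip_self H_closed)
  finally show ?thesis
    unfolding ip_self[OF H_closed(3)[OF x y]] of_real_eq_iff .
qed

lemma ip_norm_tendsto:
  assumes X: "\<And>n. X n \<in> H" and L: "L \<in> H" and lim: "((\<lambda>n. ip_norm ip (X n - L)) \<longlongrightarrow> 0) F"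
  shows "((\<lambda>n. ip_norm ip (X n)) \<longlongrightarrow> ip_norm ip L) F"
proof (rule Lim_null[THEN iffD2], rule Lim_null_comparison[OF always_eventually lim], rule allI)
  fix n
  have "ip_norm ip (X n) \<le> ip_norm ip (X n - L) + ip_norm ip L"
    using ip_norm_triangle[of "X n - L" L] X L by (simp add: H_closed)
  moreover have "ip_norm ip L \<le> ip_norm ip (X n - L) + ip_norm ip (X n)"
    using ip_norm_triangle[of "L - X n" "X n"] X L by (simp add: H_closed ip_norm_minus_commute)
  ultimately show "norm (ip_norm ip (X n) - ip_norm ip L) \<le> ip_norm ip (X n - L)"
    by (simp add: abs_le_iff)
qed

lemma ip_tendsto:
  assumes X: "\<And>n. X n \<in> H" and L: "L \<in> H" and XL: "((\<lambda>n. ip_norm ip (X n - L)) \<longlongrightarrow> 0) F"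
    and Y: "\<And>n. Y n \<in> H" and M: "M \<in> H" and YM: "((\<lambda>n. ip_norm ip (Y n - M)) \<longlongrightarrow> 0) F"
  shows "((\<lambda>n. ip (X n) (Y n)) \<longlongrightarrow> ip L M) F"
proof (rule Lim_null[THEN iffD2], rule Lim_null_comparison[OF always_eventually], rule allI)
  fix n
  have "ip (X n) (Y n) - ip L M = ip (X n - L) (Y n) + ip L (Y n - M)"
    using X Y L M by (simp add: ip_bilinear H_closed)
  also have "norm \<dots> \<le> ip_norm ip (X n - L) * ip_norm ip (Y n) + ip_norm ip L * ip_norm ip (Y n - M)"
    using X Y L M
    by (intro order_trans[OF norm_triangle_ineq] add_mono Cauchy_Schwarz) (simp_all add: H_closed)
  finally show "norm (ip (X n) (Y n) - ip L M)
      \<le> ip_norm ip (X n - L) * ip_norm ip (Y n) + ip_norm ip L * ip_norm ip (Y n - M)" .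
next
  show "((\<lambda>n. ip_norm ip (X n - L) * ip_norm ip (Y n) + ip_norm ip L * ip_norm ip (Y n - M)) \<longlongrightarrow> 0) F"
    using tendsto_add[OF tendsto_mult[OF XL ip_norm_tendsto[OF Y M YM]]
        tendsto_mult[OF tendsto_const[of "ip_norm ip L"] YM]] by simp
qed

text \<open>
  If \<open>f\<close> is orthogonal to \<open>d\<close>, then \<open>\<parallel>f\<parallel>\<^sup>2 = \<langle>f, f - d\<rangle>\<close>, and \<open>f - d\<close> can be made shorter than \<open>f\<close>.
\<close>

lemma orthogonal_dense_imp_zero:
  assumes f: "f \<in> H" and D: "dense_on H ip D" and orth: "\<And>d. d \<in> D \<Longrightarrow> ip f d = 0"
  shows "f = 0"
proof (rule ccontr)
  assume "f \<noteq> 0"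
  then have pos: "0 < ip_norm ip f"
    using f ip_norm_eq_0[of f] ip_norm_nonneg[of f] by linarith
  then obtain d where d: "d \<in> D" "ip_norm ip (f - d) < ip_norm ip f"
    using D f unfolding dense_on_def by blast
  have dH: "d \<in> H" using d(1) D by (auto simp: dense_on_def)
  have "ip f f = ip f (f - d)"
    using f dH orth[OF d(1)] by (simp add: ip_bilinear)
  then have "(ip_norm ip f)\<^sup>2 \<le> ip_norm ip f * ip_norm ip (f - d)"
    using Cauchy_Schwarz[of f "f - d"] f dH by (simp add: ip_norm_def H_closed)
  then show False
    using pos d(2) by (simp add: power2_eq_square)
qed

end

context hilbert_space_on
begin

text \<open>
  The representing vector is a multiple of the shortest vector \<open>L\<close> of the affine hyperplane
  \<open>{x. \<phi> x = 1}\<close>. By the parallelogram law a minimizing sequence is Cauchy, because midpoints stay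
  in the hyperplane; its limit \<open>L\<close> is orthogonal to the kernel of \<open>\<phi>\<close>, because otherwise a
  move along the kernel would shorten it.
\<close>

lemma Riesz_representation:
  assumes add: "\<And>x y. \<lbrakk>x \<in> H; y \<in> H\<rbrakk> \<Longrightarrow> \<phi> (x + y) = \<phi> x + \<phi> y"
    and hom: "\<And>c x. x \<in> H \<Longrightarrow> \<phi> (scale c x) = c * \<phi> x"
    and bound: "\<And>x. x \<in> H \<Longrightarrow> norm (\<phi> x) \<le> C * ip_norm ip x"
  shows "\<exists>h\<in>H. \<forall>x\<in>H. \<phi> x = ip x h"
proof (cases "\<forall>x\<in>H. \<phi> x = 0")
  case True
  then show ?thesis using H_closed(1) by (intro bexI[of _ 0]) auto
next
  case False
  define M where "M = {x \<in> H. \<phi> x = 1}"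
  define d where "d = (INF x\<in>M. ip_norm ip x)"
  have diff: "\<phi> (x - y) = \<phi> x - \<phi> y" if "x \<in> H" "y \<in> H" for x y
    using add[of x "scale (- 1) y"] hom[of y "- 1"] that by (simp add: H_closed)
  from False obtain x0 where x0: "x0 \<in> H" "\<phi> x0 \<noteq> 0" by blast
  have "scale (inverse (\<phi> x0)) x0 \<in> M"
    using x0 by (simp add: M_def hom H_closed)
  then have Mne: "M \<noteq> {}" by blast
  have MH: "x \<in> H" if "x \<in> M" for x using that by (simp add: M_def)
  have bdd: "bdd_below (ip_norm ip ` M)"
    by (rule bdd_belowI[of _ 0]) auto
  have d_le: "d \<le> ip_norm ip x" if "x \<in> M" for x
    unfolding d_def using bdd that by (rule cINF_lower)
  have d0: "0 \<le> d"
    unfolding d_def using Mne by (rule cINF_greatest) simp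
  have "\<exists>x\<in>M. ip_norm ip x < d + inverse (Suc n)" for n
    using cINF_less_iff[OF Mne bdd, of "d + inverse (Suc n)"] by (simp add: d_def)
  then obtain X where XM: "\<And>n. X n \<in> M" and Xd: "\<And>n. ip_norm ip (X n) < d + inverse (Suc n)"
    by metis
  have XH: "X n \<in> H" for n using XM MH by blast
  have mid: "2 * d \<le> ip_norm ip (X m + X n)" for m n
  proof -
    have "scale (of_real (1/2)) (X m + X n) \<in> M"
      using XM[of m] XM[of n] by (simp add: M_def H_closed hom add)
    from d_le[OF this] show ?thesis
      using ip_norm_scale[of "X m + X n" "of_real (1/2)"] XH by (simp add: H_closed)
  qed
  have small: "(ip_norm ip (X m - X n))\<^sup>2 \<le> (8 * d + 4) * inverse (Suc N)"
    if "N \<le> m" "N \<le> n" for m n N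
  proof -
    let ?e = "inverse (real (Suc N))"
    have e: "0 \<le> ?e" "?e \<le> 1" by (auto simp: field_simps)
    have sq: "(ip_norm ip (X k))\<^sup>2 \<le> (d + ?e)\<^sup>2" if "N \<le> k" for k
    proof (rule power_mono)
      have "inverse (real (Suc k)) \<le> ?e" using that by (intro le_imp_inverse_le) auto
      then show "ip_norm ip (X k) \<le> d + ?e" using Xd[of k] by linarith
    qed simp
    have "(2 * d)\<^sup>2 \<le> (ip_norm ip (X m + X n))\<^sup>2"
      using mid d0 by (intro power_mono) auto
    then have "(ip_norm ip (X m - X n))\<^sup>2 \<le> 4 * (d + ?e)\<^sup>2 - (2 * d)\<^sup>2"
      using parallelogram[OF XH XH, of m n] sq[OF that(1)] sq[OF that(2)] by linarith
    also have "\<dots> = 8 * d * ?e + 4 * (?e * ?e)"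
      by (simp add: power2_eq_square algebra_simps)
    also have "\<dots> \<le> 8 * d * ?e + 4 * ?e"
      using mult_left_mono[OF e(2) e(1)] by linarith
    finally show ?thesis by (simp add: algebra_simps)
  qed
  have "\<exists>N. \<forall>m\<ge>N. \<forall>n\<ge>N. ip_norm ip (X m - X n) < e" if e: "0 < e" for e
  proof -
    have "(\<lambda>N. (8 * d + 4) * inverse (real (Suc N))) \<longlonglongrightarrow> 0"
      using tendsto_mult[OF tendsto_const LIMSEQ_inverse_real_of_nat] by simp
    then have "\<forall>\<^sub>F N in sequentially. (8 * d + 4) * inverse (real (Suc N)) < e\<^sup>2"
      using e by (intro order_tendstoD) auto
    then obtain N where N: "(8 * d + 4) * inverse (real (Suc N)) < e\<^sup>2"
      by (auto simp: eventually_sequentially)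
    have "ip_norm ip (X m - X n) < e" if "N \<le> m" "N \<le> n" for m n
      using small[OF that] N e by (intro power2_less_imp_less[of _ e]) auto
    then show ?thesis by blast
  qed
  from complete_H[OF XH this] obtain L
    where L: "L \<in> H" and XL: "(\<lambda>n. ip_norm ip (X n - L)) \<longlonglongrightarrow> 0" by blast
  have "(\<lambda>n. norm (\<phi> (X n - L))) \<longlonglongrightarrow> 0"
  proof (rule Lim_null_comparison[OF always_eventually], rule allI)
    show "norm (norm (\<phi> (X n - L))) \<le> C * ip_norm ip (X n - L)" for n
      using bound[of "X n - L"] XH L by (simp add: H_closed)
    show "(\<lambda>n. C * ip_norm ip (X n - L)) \<longlonglongrightarrow> 0"
      using tendsto_mult[OF tendsto_const XL] by simp
  qed
  moreover have "\<phi> (X n - L) = 1 - \<phi> L" for n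
    using XM[of n] L by (simp add: M_def diff)
  ultimately have \<phi>L: "\<phi> L = 1"
    by (simp add: LIMSEQ_const_iff)
  have "(\<lambda>n. ip_norm ip (X n)) \<longlonglongrightarrow> ip_norm ip L"
    using XH L XL by (rule ip_norm_tendsto)
  moreover have "(\<lambda>n. d + inverse (real (Suc n))) \<longlonglongrightarrow> d + 0"
    by (intro tendsto_intros LIMSEQ_inverse_real_of_nat)
  ultimately have Ld: "ip_norm ip L \<le> d"
    using Xd by (intro LIMSEQ_le[of "\<lambda>n. ip_norm ip (X n)"]) (auto intro: less_imp_le)
  have orth: "ip u L = 0" if u: "u \<in> H" "\<phi> u = 0" for u
  proof (rule ccontr)
    assume nz: "ip u L \<noteq> 0"
    then have "u \<noteq> 0" using L by auto
    then have u0: "0 < ip_norm ip u"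
      using u(1) ip_norm_eq_0[of u] ip_norm_nonneg[of u] by linarith
    let ?b = "(ip_norm ip u)\<^sup>2"
    \<comment> \<open>This is the coefficient of the orthogonal projection of \<open>L\<close> onto the line of \<open>u\<close>.\<close>
    define t where "t = kconj (ip u L) * of_real (inverse ?b)"
    define v where "v = L - scale t u"
    have b0: "?b \<noteq> 0" using u0 by simp
    have vM: "v \<in> M" using u L \<phi>L by (simp add: v_def M_def diff hom H_closed)
    have tt: "kconj t = ip u L * of_real (inverse ?b)"
      by (simp add: t_def kconj_mult kconj_of_real kconj_kconj del: of_real_inverse)
    have "ip v v = ip L L - t * ip u L - kconj t * ip L u + t * kconj t * ip u u"
      using u L by (simp add: v_def ip_bilinear H_closed algebra_simps)
    also have "t * kconj t * ip u u = t * ip u L * of_real (inverse ?b * ?b)"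
      using u by (simp add: tt ip_self)
    also have "inverse ?b * ?b = 1" using b0 by simp
    also have "ip L L - t * ip u L - kconj t * ip L u + t * ip u L * of_real 1
        = ip L L - of_real (inverse ?b) * (ip u L * kconj (ip u L))"
      using u L by (simp add: tt ip_hermitian[of u L] algebra_simps)
    also have "\<dots> = of_real ((ip_norm ip L)\<^sup>2 - inverse ?b * (norm (ip u L))\<^sup>2)"
      using L by (simp add: mult_kconj ip_self)
    finally have "(ip_norm ip v)\<^sup>2 = (ip_norm ip L)\<^sup>2 - inverse ?b * (norm (ip u L))\<^sup>2"
      unfolding ip_self[OF MH[OF vM]] of_real_eq_iff .
    moreover have "0 < inverse ?b * (norm (ip u L))\<^sup>2" using nz u0 by simp
    moreover have "(ip_norm ip L)\<^sup>2 \<le> (ip_norm ip v)\<^sup>2"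
      using Ld d_le[OF vM] by (intro power_mono) auto
    ultimately show False by linarith
  qed
  have LL: "ip L L \<noteq> 0"
  proof
    assume "ip L L = 0"
    then have "scale 0 L = L" using ip_definite[OF L] by simp
    then show False using hom[OF L, of 0] \<phi>L by simp
  qed
  let ?h = "scale (inverse (ip L L)) L"
  have real: "kconj (inverse (ip L L)) = inverse (ip L L)"
    unfolding ip_self[OF L] of_real_inverse[symmetric] kconj_of_real ..
  have "\<phi> x = ip x ?h" if x: "x \<in> H" for x
  proof -
    have "ip (x - scale (\<phi> x) L) L = 0"
      using x L \<phi>L by (intro orth) (simp_all add: H_closed diff hom)
    then have "ip x L = \<phi> x * ip L L" using x L by (simp add: ip_bilinear H_closed)
    then show ?thesis using LL by (simp add: ip_scale_right[OF L x] real)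
  qed
  then show ?thesis using H_closed(4)[OF L] by blast
qed

end

section \<open>Adjoints\<close>

lemma adjoint_on_eqI:
  assumes "inner_product_space_on scaleV V ipV"
    and x: "x \<in> V" "\<And>u. u \<in> V \<Longrightarrow> ipW (T u) y = ipV u x"
  shows "adjoint_on V ipV ipW T y = x"
  unfolding adjoint_on_def
proof (rule the_equality)
  interpret V: inner_product_space_on scaleV V ipV by fact
  fix x' assume x': "x' \<in> V \<and> (\<forall>u\<in>V. ipW (T u) y = ipV u x')"
  then have "ipV (x' - x) (x' - x) = 0"
    using x V.H_closed by (metis V.ip_diff_right eq_iff_diff_eq_0)
  then show "x' = x"
    using x' x(1) V.ip_definite[of "x' - x"] by (simp add: V.H_closed)
qed (use x in blast)

text \<open>
  By Riesz, since \<open>u \<mapsto> \<langle>T u, y\<rangle>\<close> is a bounded functional.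
\<close>

lemma adjoint_on:
  assumes "hilbert_space_on scaleV V ipV" and "inner_product_space_on scaleW W ipW"
    and T: "bounded_operator_on scaleV V ipV scaleW W ipW T" and y: "y \<in> W"
  shows "adjoint_on V ipV ipW T y \<in> V"
    and "u \<in> V \<Longrightarrow> ipW (T u) y = ipV u (adjoint_on V ipV ipW T y)"
proof -
  interpret V: hilbert_space_on scaleV V ipV by fact
  interpret W: inner_product_space_on scaleW W ipW by fact
  from T obtain C where TW: "\<And>x. x \<in> V \<Longrightarrow> T x \<in> W"
    and C: "\<And>x. x \<in> V \<Longrightarrow> ip_norm ipW (T x) \<le> C * ip_norm ipV x"
    unfolding bounded_operator_on_def by blast
  have "\<exists>h\<in>V. \<forall>x\<in>V. ipW (T x) y = ipV x h"
  proof (rule V.Riesz_representation)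
    fix x assume x: "x \<in> V"
    have "norm (ipW (T x) y) \<le> ip_norm ipW (T x) * ip_norm ipW y"
      using x y TW by (intro W.Cauchy_Schwarz)
    also have "\<dots> \<le> C * ip_norm ipV x * ip_norm ipW y"
      using C[OF x] by (rule mult_right_mono) simp
    finally show "norm (ipW (T x) y) \<le> C * ip_norm ipW y * ip_norm ipV x"
      by (simp add: mult_ac)
  qed (use T y TW in \<open>auto simp: bounded_operator_on_def W.ip_bilinear\<close>)
  then obtain h where h: "h \<in> V" "\<And>x. x \<in> V \<Longrightarrow> ipW (T x) y = ipV x h" by blast
  then have "adjoint_on V ipV ipW T y = h"
    by (intro adjoint_on_eqI[OF V.inner_product_space_on_axioms])
  with h show "adjoint_on V ipV ipW T y \<in> V"
    and "u \<in> V \<Longrightarrow> ipW (T u) y = ipV u (adjoint_on V ipV ipW T y)" by simp_all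
qed

section \<open>Square-summable sequences and matrices of operators\<close>

lemma summable_norm_ell2_product:
  assumes "x \<in> ell2" "y \<in> ell2"
  shows "summable (\<lambda>n. norm (x n * kconj (y n)))"
proof (rule summable_comparison_test')
  show "summable (\<lambda>n. (norm (x n))\<^sup>2 + (norm (y n))\<^sup>2)"
    using assms by (auto simp: ell2_def intro: summable_add)
  show "norm (norm (x n * kconj (y n))) \<le> (norm (x n))\<^sup>2 + (norm (y n))\<^sup>2" for n
  proof -
    have "2 * (norm (x n) * norm (y n)) \<le> (norm (x n))\<^sup>2 + (norm (y n))\<^sup>2"
      using sum_squares_bound[of "norm (x n)" "norm (y n)"] by simp
    moreover have "0 \<le> norm (x n) * norm (y n)" by simp
    ultimately show ?thesis unfolding norm_mult norm_kconj real_norm_def abs_mult abs_norm_cancel by linarith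
  qed
qed

lemmas summable_ell2_product = summable_norm_cancel[OF summable_norm_ell2_product]

lemma ell2_ip_self: "x \<in> ell2 \<Longrightarrow> ell2_ip x x = of_real (\<Sum>n. (norm (x n))\<^sup>2)"
  unfolding ell2_ip_def mult_kconj by (rule suminf_of_real[symmetric]) (simp add: ell2_def)

interpretation ell2: inner_product_space_on fun_scale ell2
  "ell2_ip :: (nat \<Rightarrow> 'k::real_or_complex) \<Rightarrow> (nat \<Rightarrow> 'k) \<Rightarrow> 'k"
proof -
  interpret vector_space "fun_scale :: 'k \<Rightarrow> (nat \<Rightarrow> 'k) \<Rightarrow> nat \<Rightarrow> 'k"
    by (rule vector_space_fun_scale)
  show "inner_product_space_on fun_scale ell2 (ell2_ip :: (nat \<Rightarrow> 'k) \<Rightarrow> (nat \<Rightarrow> 'k) \<Rightarrow> 'k)"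
  proof
    show "subspace (ell2 :: (nat \<Rightarrow> 'k) set)"
    proof (rule subspaceI)
      fix x y :: "nat \<Rightarrow> 'k" assume xy: "x \<in> ell2" "y \<in> ell2"
      show "x + y \<in> ell2"
        unfolding ell2_def mem_Collect_eq
      proof (rule summable_comparison_test')
        show "summable (\<lambda>n. 2 * (norm (x n))\<^sup>2 + 2 * (norm (y n))\<^sup>2)"
          using xy by (auto simp: ell2_def intro!: summable_add summable_mult)
        show "norm ((norm ((x + y) n))\<^sup>2) \<le> 2 * (norm (x n))\<^sup>2 + 2 * (norm (y n))\<^sup>2" for n
        proof -
          have "(norm (x n + y n))\<^sup>2 \<le> (norm (x n) + norm (y n))\<^sup>2"
            by (intro power_mono norm_triangle_ineq) simp
          also have "\<dots> \<le> 2 * (norm (x n))\<^sup>2 + 2 * (norm (y n))\<^sup>2"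
            using sum_squares_bound[of "norm (x n)" "norm (y n)"] by (simp add: power2_sum)
          finally show ?thesis by simp
        qed
      qed
    qed (auto simp: ell2_def fun_scale_def norm_mult power_mult_distrib intro: summable_mult)
  next
    fix x y z :: "nat \<Rightarrow> 'k" and c :: 'k
    { assume "x \<in> ell2" "y \<in> ell2" "z \<in> ell2"
      then show "ell2_ip (x + y) z = ell2_ip x z + ell2_ip y z"
        by (simp add: ell2_ip_def distrib_right suminf_add summable_ell2_product) }
    { assume xy: "x \<in> ell2" "y \<in> ell2"
      then show "ell2_ip (fun_scale c x) y = c * ell2_ip x y"
        by (simp add: ell2_ip_def fun_scale_def mult.assoc suminf_mult summable_ell2_product)
      show "ell2_ip y x = kconj (ell2_ip x y)"
        unfolding ell2_ip_def bounded_linear.suminf[OF bounded_linear_kconj summable_ell2_product[OF xy]]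
        by (simp add: kconj_mult kconj_kconj mult.commute) }
    assume x: "x \<in> ell2"
    then have s: "summable (\<lambda>n. (norm (x n))\<^sup>2)" by (simp add: ell2_def)
    show "\<exists>r\<ge>0. ell2_ip x x = of_real r"
      unfolding ell2_ip_self[OF x] using s by (auto intro!: suminf_nonneg)
    assume "ell2_ip x x = 0"
    then have "(\<Sum>n. (norm (x n))\<^sup>2) = 0" unfolding ell2_ip_self[OF x] by simp
    then show "x = 0"
      using suminf_eq_zero_iff[OF s] by (simp add: fun_eq_iff)
  qed
qed

definition truncate :: "nat \<Rightarrow> (nat \<Rightarrow> 'k::real_or_complex) \<Rightarrow> nat \<Rightarrow> 'k" where
  "truncate N x = (\<lambda>n. if n < N then x n else 0)"

lemma truncate_Suc: "truncate (Suc N) x = truncate N x + fun_scale (x N) (std_basis N)"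
  by (auto simp: truncate_def std_basis_def fun_scale_def fun_eq_iff less_Suc_eq)

lemma truncate_0: "truncate 0 x = 0"
  by (simp add: truncate_def fun_eq_iff)

lemma std_basis_in_ell2 [simp]: "std_basis m \<in> ell2"
proof -
  have "summable (\<lambda>n. (norm (std_basis m n :: 'a))\<^sup>2)"
    by (rule summable_finite[of "{m}"]) (auto simp: std_basis_def)
  then show ?thesis by (simp add: ell2_def)
qed

lemma truncate_in_ell2 [simp]: "truncate N x \<in> ell2"
  unfolding ell2_def truncate_def mem_Collect_eq
  by (rule summable_finite[of "{..<N}"]) auto

text \<open>
  The squared distance is the tail of the convergent series \<open>\<Sum>\<bar>x\<^sub>n\<bar>\<^sup>2\<close>.
\<close>

lemma truncate_tendsto:
  fixes x :: "nat \<Rightarrow> 'k::real_or_complex"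
  assumes x: "x \<in> ell2"
  shows "(\<lambda>N. ip_norm ell2_ip (truncate N x - x)) \<longlonglongrightarrow> 0"
proof -
  define a where "a n = (norm (x n))\<^sup>2" for n
  have a: "summable a" using x by (simp add: ell2_def a_def[abs_def])
  have "(ip_norm ell2_ip (truncate N x - x))\<^sup>2 = suminf a - sum a {..<N}" for N
  proof -
    have d: "truncate N x - x \<in> ell2" using x by (simp add: ell2.H_closed)
    have "(\<lambda>n. (norm ((truncate N x - x) n))\<^sup>2) = (\<lambda>n. a n - (if n \<in> {..<N} then a n else 0))"
      by (auto simp: truncate_def a_def)
    then have "(\<lambda>n. (norm ((truncate N x - x) n))\<^sup>2) sums (suminf a - sum a {..<N})"
      using sums_diff[OF summable_sums[OF a] sums_If_finite_set[of "{..<N}" a]] by simp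
    then have "ell2_ip (truncate N x - x) (truncate N x - x) = (of_real (suminf a - sum a {..<N}) :: 'k)"
      unfolding ell2_ip_self[OF d] using sums_unique by metis
    then show ?thesis unfolding ell2.ip_self[OF d] of_real_eq_iff .
  qed
  then have "ip_norm ell2_ip (truncate N x - x) = sqrt (suminf a - sum a {..<N})" for N
    by (metis ell2.ip_norm_nonneg real_sqrt_unique)
  moreover have "(\<lambda>N. sqrt (suminf a - sum a {..<N})) \<longlonglongrightarrow> sqrt (suminf a - suminf a)"
    by (intro tendsto_intros summable_LIMSEQ a)
  ultimately show ?thesis by simp
qed

text \<open>
  A rectangular partial sum of the matrix form is the form of the operator at truncated vectors,
  so that the double series can be summed without absolute convergence.
\<close>

lemma double_partial_sum_eq_ell2_ip:
  assumes T: "ell2_bounded_operator T"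
  shows "double_partial_sum (\<lambda>n m. kconj (x n) * matrix_entry T n m * y m) (N, M)
       = ell2_ip (T (truncate M y)) (truncate N x)"
proof -
  have T_in: "T u \<in> ell2" if "u \<in> ell2" for u using T that by (simp add: bounded_operator_on_def)
  have T0: "T 0 = 0"
  proof -
    have "T 0 = T 0 + T 0"
      using T ell2.H_closed(1) unfolding bounded_operator_on_def by (metis add_0)
    then show ?thesis by simp
  qed
  have left: "ell2_ip (T (truncate M y)) v = (\<Sum>m<M. y m * ell2_ip (T (std_basis m)) v)"
    if v: "v \<in> ell2" for v
  proof (induction M)
    case 0
    have "ell2_ip (T (truncate 0 y)) v = 0" using v by (metis T0 truncate_0 ell2.ip_zero_left)
    then show ?case by simp
  next
    case (Suc M)
    have "T (truncate (Suc M) y) = T (truncate M y) + fun_scale (y M) (T (std_basis M))"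
      using T by (simp add: bounded_operator_on_def truncate_Suc ell2.H_closed)
    then have "ell2_ip (T (truncate (Suc M) y)) v
        = ell2_ip (T (truncate M y)) v + y M * ell2_ip (T (std_basis M)) v"
      using v by (metis T_in ell2.H_closed(4) ell2.ip_add_left ell2.ip_scale_left std_basis_in_ell2 truncate_in_ell2)
    then show ?case using Suc by simp
  qed
  have right: "ell2_ip u (truncate N x) = (\<Sum>n<N. kconj (x n) * ell2_ip u (std_basis n))"
    if u: "u \<in> ell2" for u
  proof (induction N)
    case 0
    have "ell2_ip u (truncate 0 x) = 0" using u by (metis truncate_0 ell2.ip_zero_right)
    then show ?case by simp
  next
    case (Suc N)
    have "ell2_ip u (truncate (Suc N) x)
        = ell2_ip u (truncate N x) + kconj (x N) * ell2_ip u (std_basis N)"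
      using u unfolding truncate_Suc
      by (metis ell2.H_closed(4) ell2.ip_add_right ell2.ip_scale_right std_basis_in_ell2 truncate_in_ell2)
    then show ?case using Suc by simp
  qed
  show ?thesis
    by (simp add: double_partial_sum_def left right T_in matrix_entry_def sum_distrib_left mult_ac)
qed

lemma double_partial_sum_tendsto:
  assumes T: "ell2_bounded_operator T" and x: "x \<in> ell2" and y: "y \<in> ell2"
  shows "(double_partial_sum (\<lambda>n m. kconj (x n) * matrix_entry T n m * y m)
    \<longlongrightarrow> ell2_ip (T y) x) (sequentially \<times>\<^sub>F sequentially)"
proof -
  from T obtain C where C: "\<And>u. u \<in> ell2 \<Longrightarrow> ip_norm ell2_ip (T u) \<le> C * ip_norm ell2_ip u"
    unfolding bounded_operator_on_def by blast
  have T_in: "T u \<in> ell2" if "u \<in> ell2" for u using T that by (simp add: bounded_operator_on_def)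
  have Tdiff: "T (u - v) = T u - T v" if "u \<in> ell2" "v \<in> ell2" for u v
  proof -
    have "T u = T (u - v) + T v"
      using T that ell2.H_closed(3)[OF that] unfolding bounded_operator_on_def
      by (metis diff_add_cancel)
    then show ?thesis by simp
  qed
  have "((\<lambda>p. ell2_ip (T (truncate (snd p) y)) (truncate (fst p) x)) \<longlongrightarrow> ell2_ip (T y) x)
      (sequentially \<times>\<^sub>F sequentially)"
  proof (rule ell2.ip_tendsto)
    show "((\<lambda>p. ip_norm ell2_ip (truncate (fst p) x - x)) \<longlongrightarrow> 0) (sequentially \<times>\<^sub>F sequentially)"
      by (rule filterlim_compose[OF truncate_tendsto[OF x] filterlim_fst])
    have "(\<lambda>M. ip_norm ell2_ip (T (truncate M y) - T y)) \<longlonglongrightarrow> 0"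
    proof (rule Lim_null_comparison[OF always_eventually], rule allI)
      show "norm (ip_norm ell2_ip (T (truncate M y) - T y))
          \<le> C * ip_norm ell2_ip (truncate M y - y)" for M
        using C[of "truncate M y - y"] y by (simp add: Tdiff ell2.H_closed)
      show "(\<lambda>M. C * ip_norm ell2_ip (truncate M y - y)) \<longlonglongrightarrow> 0"
        using tendsto_mult[OF tendsto_const truncate_tendsto[OF y]] by simp
    qed
    from filterlim_compose[OF this filterlim_snd]
    show "((\<lambda>p. ip_norm ell2_ip (T (truncate (snd p) y) - T y)) \<longlongrightarrow> 0)
        (sequentially \<times>\<^sub>F sequentially)" .
  qed (use x y T_in in auto)
  moreover have "double_partial_sum (\<lambda>n m. kconj (x n) * matrix_entry T n m * y m)
      = (\<lambda>p. ell2_ip (T (truncate (snd p) y)) (truncate (fst p) x))"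
    using double_partial_sum_eq_ell2_ip[OF T] by (auto simp: fun_eq_iff)
  ultimately show ?thesis by simp
qed

section \<open>Hahn-Banach theorem by minimal sublinear functionals\<close>

locale real_sublinear = vector_space s
  for s :: "real \<Rightarrow> 'v::ab_group_add \<Rightarrow> 'v" +
  fixes p :: "'v \<Rightarrow> real"
  assumes subadditive: "p (x + y) \<le> p x + p y"
    and pos_homogeneous: "0 < t \<Longrightarrow> p (s t x) = t * p x"
begin

lemma at_zero: "p 0 = 0"
  using pos_homogeneous[of 2 0] by simp

lemma pos_homogeneous0: "0 \<le> t \<Longrightarrow> p (s t x) = t * p x"
  by (cases "t = 0") (simp_all add: at_zero pos_homogeneous)

lemma neg_le: "- p (- x) \<le> p x"
  using subadditive[of x "- x"] by (simp add: at_zero)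

text \<open>
  The functional \<open>tilt y\<close> is the largest sublinear functional below \<open>p\<close> with value at most \<open>- p y\<close>
  at \<open>- y\<close>. It has two uses: a minimal \<open>p\<close> must coincide with all its tilts, which forces additivity;
  and a linear functional below \<open>tilt y\<close> attains the value \<open>p y\<close> at \<open>y\<close>.
\<close>

definition tilt :: "'v \<Rightarrow> 'v \<Rightarrow> real" where
  "tilt y x = (INF t\<in>{0..}. p (x + s t y) - t * p y)"

lemma tilt_bdd_below: "bdd_below ((\<lambda>t. p (x + s t y) - t * p y) ` {0..})"
proof (rule bdd_belowI2)
  fix t :: real assume "t \<in> {0..}"
  then have "p (s t y) = t * p y" by (simp add: pos_homogeneous0)
  moreover have "p (s t y) \<le> p (x + s t y) + p (- x)"
    using subadditive[of "x + s t y" "- x"] by simp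
  ultimately show "- p (- x) \<le> p (x + s t y) - t * p y" by linarith
qed

lemma tilt_le: "0 \<le> t \<Longrightarrow> tilt y x \<le> p (x + s t y) - t * p y"
  unfolding tilt_def by (rule cINF_lower[OF tilt_bdd_below]) simp

lemma tilt_greatest:
  "(\<And>t. 0 \<le> t \<Longrightarrow> r \<le> p (x + s t y) - t * p y) \<Longrightarrow> r \<le> tilt y x"
  unfolding tilt_def by (rule cINF_greatest) auto

lemma tilt_le_self: "tilt y x \<le> p x"
  using tilt_le[of 0 y x] by simp

lemma tilt_uminus: "tilt y (- y) \<le> - p y"
  using tilt_le[of 1 y "- y"] by (simp add: at_zero)

lemma real_sublinear_tilt: "real_sublinear s (tilt y)"
proof unfold_locales
  fix x z
  have "tilt y (x + z) - (p (z + s u y) - u * p y) \<le> tilt y x" if u: "0 \<le> u" for u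
  proof (rule tilt_greatest)
    fix t :: real assume t: "0 \<le> t"
    have "tilt y (x + z) \<le> p ((x + s t y) + (z + s u y)) - (t + u) * p y"
      using tilt_le[of "t + u" y "x + z"] t u by (simp add: scale_left_distrib add_ac)
    also have "\<dots> \<le> p (x + s t y) + p (z + s u y) - (t + u) * p y"
      using subadditive[of "x + s t y" "z + s u y"] by simp
    finally show "tilt y (x + z) - (p (z + s u y) - u * p y) \<le> p (x + s t y) - t * p y"
      by (simp add: algebra_simps)
  qed
  then have "tilt y (x + z) - tilt y x \<le> tilt y z"
    by (intro tilt_greatest) (simp add: algebra_simps)
  then show "tilt y (x + z) \<le> tilt y x + tilt y z" by simp
next
  fix c :: real and x assume c: "0 < c"
  have le: "tilt y (s c x) \<le> c * tilt y x" if c: "0 < c" for c x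
  proof -
    have "tilt y (s c x) / c \<le> tilt y x"
    proof (rule tilt_greatest)
      fix t :: real assume t: "0 \<le> t"
      have "tilt y (s c x) \<le> p (s c (x + s t y)) - (c * t) * p y"
        using tilt_le[of "c * t" y "s c x"] t c by (simp add: scale_right_distrib)
      also have "\<dots> = c * (p (x + s t y) - t * p y)"
        unfolding pos_homogeneous[OF c] by (simp add: algebra_simps)
      finally show "tilt y (s c x) / c \<le> p (x + s t y) - t * p y"
        using c by (simp add: divide_le_eq mult.commute)
    qed
    then show ?thesis using c by (simp add: divide_le_eq mult.commute)
  qed
  have "tilt y x \<le> (1 / c) * tilt y (s c x)"
    using le[of "1 / c" "s c x"] c by simp
  then have "c * tilt y x \<le> tilt y (s c x)" using c by (simp add: field_simps)
  with le[OF c] show "tilt y (s c x) = c * tilt y x" by (rule antisym)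
qed

text \<open>
  If \<open>tilt y = p\<close>, then \<open>p x \<le> p (x + y) - p y\<close>, which is the missing half of additivity.
\<close>

lemma minimal_imp_linear:
  assumes min: "\<And>q. real_sublinear s q \<Longrightarrow> q \<le> p \<Longrightarrow> q = p"
  shows "p (x + y) = p x + p y" and "p (s t x) = t * p x"
proof -
  have "tilt y = p" for y
    using real_sublinear_tilt tilt_le_self by (intro min) (auto simp: le_fun_def)
  then have add: "p (x + y) = p x + p y" for x y
    using tilt_le[of 1 y x] subadditive[of x y] by simp
  then show "p (x + y) = p x + p y" .
  have neg: "p (- x) = - p x" for x
    using add[of x "- x"] by (simp add: at_zero)
  show "p (s t x) = t * p x"
  proof (cases "0 \<le> t")
    case False
    then have "p (s (- t) x) = (- t) * p x" by (intro pos_homogeneous0) simp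
    then show ?thesis by (simp add: neg)
  qed (rule pos_homogeneous0)
qed

text \<open>
  Zorn's lemma: the pointwise infimum of a chain of sublinear functionals below \<open>p\<close> is again one. It is
  finite since \<open>- p (- x)\<close> bounds all of them from below, and subadditive since two members of
  a chain can be replaced by the smaller one.
\<close>

lemma minimal_sublinear_below:
  "\<exists>f. real_sublinear s f \<and> f \<le> p \<and> (\<forall>q. real_sublinear s q \<longrightarrow> q \<le> f \<longrightarrow> q = f)"
proof -
  define A where "A = {q. real_sublinear s q \<and> q \<le> p}"
  have pA: "p \<in> A" by (simp add: A_def real_sublinear_axioms)
  have "\<exists>m\<in>A. \<forall>a\<in>A. m \<ge> a \<longrightarrow> a = m"
  proof (rule predicate_Zorn)
    show "partial_order_on A (relation_of (\<ge>) A)"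
      by (rule partial_order_on_relation_ofI) auto
  next
    fix C assume C: "C \<in> Chains (relation_of (\<ge>) A)"
    then have CA: "C \<subseteq> A" by (auto simp: Chains_def relation_of_def)
    have total: "a \<le> b \<or> b \<le> a" if "a \<in> C" "b \<in> C" for a b
      using C that by (auto simp: Chains_def relation_of_def)
    show "\<exists>u\<in>A. \<forall>a\<in>C. u \<le> a"
    proof (cases "C = {}")
      case True then show ?thesis using pA by blast
    next
      case False
      define u where "u x = (INF q\<in>C. q x)" for x
      have sub: "real_sublinear s q" and qp: "q \<le> p" if "q \<in> C" for q
        using CA that by (auto simp: A_def)
      have bdd: "bdd_below ((\<lambda>q. q x) ` C)" for x
      proof (rule bdd_belowI2)
        fix q assume q: "q \<in> C"
        have "- q (- x) \<le> q x" by (rule real_sublinear.neg_le[OF sub[OF q]])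
        moreover have "q (- x) \<le> p (- x)" using qp[OF q] by (simp add: le_fun_def)
        ultimately show "- p (- x) \<le> q x" by linarith
      qed
      have ule: "u x \<le> q x" if "q \<in> C" for q x
        unfolding u_def using bdd that by (rule cINF_lower)
      have ugr: "r \<le> u x" if "\<And>q. q \<in> C \<Longrightarrow> r \<le> q x" for r x
        unfolding u_def using False that by (rule cINF_greatest)
      have "real_sublinear s u"
      proof unfold_locales
        fix x y
        have "u (x + y) - q y \<le> u x" if q: "q \<in> C" for q
        proof (rule ugr)
          fix q' assume q': "q' \<in> C"
          define m where "m = (if q \<le> q' then q else q')"
          have m: "m \<in> C" "m \<le> q" "m \<le> q'"
            using q q' total[OF q q'] by (auto simp: m_def)
          have "u (x + y) \<le> m x + m y"
            using ule[OF m(1), of "x + y"] real_sublinear.subadditive[OF sub[OF m(1)], of x y]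
            by linarith
          also have "\<dots> \<le> q' x + q y"
            using m(2,3) by (intro add_mono) (auto simp: le_fun_def)
          finally show "u (x + y) - q y \<le> q' x" by simp
        qed
        then have "u (x + y) - u x \<le> u y"
          by (intro ugr) (simp add: algebra_simps)
        then show "u (x + y) \<le> u x + u y" by simp
      next
        fix t :: real and x assume t: "0 < t"
        have hom: "q (s t x) = t * q x" if "q \<in> C" for q
          using real_sublinear.pos_homogeneous[OF sub[OF that] t] .
        have "u (s t x) / t \<le> u x"
          using ule[of _ "s t x"] t by (intro ugr) (simp add: hom divide_le_eq mult.commute)
        moreover have "t * u x \<le> u (s t x)"
          using ule[of _ x] t by (intro ugr) (simp add: hom)
        ultimately show "u (s t x) = t * u x" using t by (simp add: divide_le_eq mult.commute)
      qed
      moreover have "u \<le> p"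
      proof (rule le_funI)
        obtain q where q: "q \<in> C" using False by blast
        show "u x \<le> p x" for x using ule[OF q, of x] le_funD[OF qp[OF q], of x] by linarith
      qed
      ultimately show ?thesis
        using ule by (auto simp: A_def le_fun_def)
    qed
  qed
  then obtain m where m: "real_sublinear s m" "m \<le> p" and min: "\<And>q. q \<in> A \<Longrightarrow> q \<le> m \<Longrightarrow> q = m"
    unfolding A_def by blast
  have "q = m" if "real_sublinear s q" "q \<le> m" for q
    using that m(2) min by (simp add: A_def)
  with m show ?thesis by blast
qed

text \<open>
  A minimal sublinear functional below \<open>tilt y\<close> will do. This gives a functional on the whole space at
  once, without extending it from subspaces.
\<close>

theorem Hahn_Banach_sublinear:
  "\<exists>f. (\<forall>x y. f (x + y) = f x + f y) \<and> (\<forall>t x. f (s t x) = t * f x) \<and> (\<forall>x. f x \<le> p x) \<and> f y = p y"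
proof -
  interpret T: real_sublinear s "tilt y" by (rule real_sublinear_tilt)
  obtain f where f: "real_sublinear s f" "f \<le> tilt y"
    and min: "\<And>q. real_sublinear s q \<Longrightarrow> q \<le> f \<Longrightarrow> q = f"
    using T.minimal_sublinear_below by blast
  interpret f: real_sublinear s f by fact
  have add: "f (x + z) = f x + f z" and hom: "f (s t x) = t * f x" for x z t
    using f.minimal_imp_linear[OF min] by blast+
  have le: "f x \<le> p x" for x
    using le_funD[OF f(2), of x] tilt_le_self[of y x] by linarith
  have "f (- y) \<le> - p y"
    using le_funD[OF f(2), of "- y"] tilt_uminus[of y] by linarith
  moreover have "f (- y) = - f y" using hom[of "- 1" y] by simp
  ultimately have "f y = p y" using le[of y] by linarith
  with add hom le show ?thesis by blast
qed

end

section \<open>Continuous functionals on a topological algebra\<close>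

context topological_algebra
begin

lemma vector_space_real: "vector_space (\<lambda>r::real. scale (of_real r))"
  by unfold_locales (simp_all add: scale_right_distrib scale_left_distrib)

lemma open_scale_vimage: "open U \<Longrightarrow> open {x. scale c (x - x0) \<in> U}"
proof -
  assume U: "open U"
  have "continuous_on UNIV ((\<lambda>(c, x). scale c x) \<circ> (\<lambda>x. (c, x - x0)))"
    by (intro continuous_on_compose continuous_intros continuous_on_subset[OF continuous_scale]) auto
  from open_vimage[OF U this] show ?thesis by (simp add: vimage_def)
qed

lemma open_zero_absorbing:
  assumes U: "open U" "0 \<in> U"
  shows "\<exists>t>0. scale (of_real t) x \<in> U"
proof -
  have "continuous_on UNIV ((\<lambda>(c, x). scale c x) \<circ> (\<lambda>t::real. (of_real t, x)))"
    by (intro continuous_on_compose continuous_intros continuous_on_subset[OF continuous_scale]) auto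
  from open_vimage[OF U(1) this] have "open {t::real. scale (of_real t) x \<in> U}"
    by (simp add: vimage_def)
  moreover have "(0::real) \<in> {t. scale (of_real t) x \<in> U}" using U by simp
  ultimately obtain e where e: "e > 0" and ball: "ball (0::real) e \<subseteq> {t. scale (of_real t) x \<in> U}"
    using open_contains_ball by blast
  have "e / 2 \<in> ball 0 e" using e by simp
  with ball have "scale (of_real (e / 2)) x \<in> U" by blast
  then show ?thesis using e half_gt_zero by blast
qed

text \<open>
  Let \<open>p\<close> be the Minkowski gauge of a convex neighbourhood \<open>V\<close> of \<open>0\<close> that misses \<open>y\<close>. Then \<open>1 \<le> p y\<close>, and
  a real linear functional below \<open>p\<close> is at most \<open>1\<close> on \<open>V\<close>, hence continuous.
\<close>

lemma exists_continuous_real_functional: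
  assumes y: "y \<noteq> 0"
  shows "\<exists>f :: 'a \<Rightarrow> real. (\<forall>x z. f (x + z) = f x + f z) \<and> (\<forall>t x. f (scale (of_real t) x) = t * f x)
    \<and> continuous_on UNIV f \<and> f y \<noteq> 0"
proof -
  obtain U where "open U" "0 \<in> U" "y \<notin> U"
    using y separation_t1[of 0 y] by metis
  then obtain V where V: "open V" "0 \<in> V" "y \<notin> V"
    and conv: "\<forall>x\<in>V. \<forall>z\<in>V. \<forall>t::real. 0 \<le> t \<and> t \<le> 1 \<longrightarrow>
      scale (of_real (1 - t)) x + scale (of_real t) z \<in> V"
    using locally_convex[of U] by blast
  have convex: "scale (of_real (1 - t)) x + scale (of_real t) z \<in> V"
    if "x \<in> V" "z \<in> V" "0 \<le> t" "t \<le> 1" for x z and t :: real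
    using conv that by blast
  define S where "S x = {t. 0 < t \<and> scale (of_real (1 / t)) x \<in> V}" for x
  define p where "p x = Inf (S x)" for x
  have Sne: "S x \<noteq> {}" for x
  proof -
    obtain t where "0 < t" "scale (of_real t) x \<in> V" using open_zero_absorbing[OF V(1,2)] by blast
    then have "1 / t \<in> S x" by (simp add: S_def)
    then show ?thesis by blast
  qed
  have bdd: "bdd_below (S x)" for x by (rule bdd_belowI[of _ 0]) (auto simp: S_def)
  have p_le: "p x \<le> t" if "t \<in> S x" for x t
    unfolding p_def using that bdd by (rule cInf_lower)
  have p_gr: "r \<le> p x" if "\<And>t. t \<in> S x \<Longrightarrow> r \<le> t" for r x
    unfolding p_def using Sne that by (rule cInf_greatest)
  interpret R: vector_space "\<lambda>r::real. scale (of_real r)" by (rule vector_space_real)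
  interpret p: real_sublinear "\<lambda>r::real. scale (of_real r)" p
  proof
    fix x z
    have S_add: "t + u \<in> S (x + z)" if t: "t \<in> S x" and u: "u \<in> S z" for t u
    proof -
      have t0: "0 < t" and u0: "0 < u" using t u by (auto simp: S_def)
      let ?c = "u / (t + u)"
      have "scale (of_real (1 - ?c)) (scale (of_real (1 / t)) x)
          + scale (of_real ?c) (scale (of_real (1 / u)) z) \<in> V"
        using t u t0 u0 by (intro convex) (auto simp: S_def)
      moreover have "scale (of_real (1 - ?c)) (scale (of_real (1 / t)) x) = scale (of_real (1 / (t + u))) x"
        unfolding R.scale_scale using t0 u0 by (intro arg_cong[of _ _ "\<lambda>r. scale (of_real r) x"]) (simp add: field_simps)
      moreover have "scale (of_real ?c) (scale (of_real (1 / u)) z) = scale (of_real (1 / (t + u))) z"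
        unfolding R.scale_scale using t0 u0 by (intro arg_cong[of _ _ "\<lambda>r. scale (of_real r) z"]) (simp add: field_simps)
      ultimately show ?thesis
        using t0 u0 unfolding S_def mem_Collect_eq scale_right_distrib by (metis add_pos_pos)
    qed
    have "p (x + z) - u \<le> p x" if u: "u \<in> S z" for u
    proof (rule p_gr)
      fix t assume "t \<in> S x"
      from p_le[OF S_add[OF this u]] show "p (x + z) - u \<le> t" by simp
    qed
    then have "p (x + z) - p x \<le> p z"
      by (intro p_gr) (simp add: algebra_simps)
    then show "p (x + z) \<le> p x + p z" by simp
  next
    fix c :: real and x assume c: "0 < c"
    have S_scale: "c * t \<in> S (scale (of_real c) x)" if "0 < c" "t \<in> S x" for c t x
      using that unfolding S_def mem_Collect_eq R.scale_scale by (simp add: mult_pos_pos)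
    have le: "p (scale (of_real c) x) \<le> c * p x" if c: "0 < c" for c x
    proof -
      have "p (scale (of_real c) x) / c \<le> p x"
      proof (rule p_gr)
        fix t assume "t \<in> S x"
        from p_le[OF S_scale[OF c this]] show "p (scale (of_real c) x) / c \<le> t"
          using c by (simp add: divide_le_eq mult.commute)
      qed
      then show ?thesis using c by (simp add: divide_le_eq mult.commute)
    qed
    have "p x \<le> (1 / c) * p (scale (of_real c) x)"
      using le[of "1 / c" "scale (of_real c) x"] c unfolding R.scale_scale by simp
    then have "c * p x \<le> p (scale (of_real c) x)" using c by (simp add: field_simps)
    with le[OF c] show "p (scale (of_real c) x) = c * p x" by (rule antisym)
  qed
  have p_y: "1 \<le> p y"
  proof (rule p_gr)
    fix t assume t: "t \<in> S y"
    show "1 \<le> t"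
    proof (rule ccontr)
      assume "\<not> 1 \<le> t"
      then have "scale (of_real (1 - t)) 0 + scale (of_real t) (scale (of_real (1 / t)) y) \<in> V"
        using t V(2) by (intro convex) (auto simp: S_def)
      then show False using V(3) t unfolding R.scale_scale by (simp add: S_def)
    qed
  qed
  obtain f where add: "\<And>x z. f (x + z) = f x + f z" and hom: "\<And>t x. f (scale (of_real t) x) = t * f x"
    and fp: "\<And>x. f x \<le> p x" and fy: "f y = p y"
    using p.Hahn_Banach_sublinear[of y] by blast
  have fV: "f x \<le> 1" if "x \<in> V" for x
    using fp[of x] p_le[of 1 x] that by (simp add: S_def)
  have f_minus: "f (- x) = - f x" for x using hom[of "- 1" x] by simp
  have f_diff: "f (x - z) = f x - f z" for x z using add[of x "- z"] f_minus[of z] by simp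
  have "isCont f x0" for x0
    unfolding isCont_def
  proof (rule tendstoI)
    fix e :: real assume e: "0 < e"
    \<comment> \<open>The factor \<open>2 / e\<close> instead of \<open>1 / e\<close> turns the weak bound of \<open>f\<close> on \<open>V\<close> into a strict one.\<close>
    let ?c = "of_real (2 / e) :: 'k"
    define W where "W = {x. scale ?c (x - x0) \<in> V} \<inter> {x. scale (- ?c) (x - x0) \<in> V}"
    have "open W" unfolding W_def by (intro open_Int open_scale_vimage V)
    moreover have "x0 \<in> W" using V(2) by (simp add: W_def)
    ultimately have "\<forall>\<^sub>F x in at x0. x \<in> W"
      using topological_tendstoD[OF tendsto_ident_at] by blast
    then show "\<forall>\<^sub>F x in at x0. dist (f x) (f x0) < e"
    proof eventually_elim
      case (elim x)
      have "f (scale ?c (x - x0)) \<le> 1" "f (scale (of_real (- (2 / e))) (x - x0)) \<le> 1"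
        using elim fV by (simp_all add: W_def)
      then have "2 / e * (f x - f x0) \<le> 1" "- (2 / e) * (f x - f x0) \<le> 1"
        unfolding hom f_diff .
      then show ?case using e by (simp add: dist_real_def field_simps abs_less_iff)
    qed
  qed
  then have "continuous_on UNIV f" by (simp add: continuous_on_eq_continuous_at)
  moreover have "f y \<noteq> 0" using fy p_y by simp
  ultimately show ?thesis using add hom by blast
qed

text \<open>
  Over \<open>\<complex>\<close> the real functional \<open>f\<close> is complexified to \<open>x \<mapsto> f x - \<i> f (\<i> x)\<close>, whose real part is \<open>f\<close>.
\<close>

theorem topological_dual_separates:
  assumes y: "y \<noteq> 0"
  shows "\<exists>a \<in> topological_dual scale. a y \<noteq> 0"
proof -
  obtain f :: "'a \<Rightarrow> real" where add: "\<And>x z. f (x + z) = f x + f z"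
    and hom: "\<And>t x. f (scale (of_real t) x) = t * f x"
    and cont: "continuous_on UNIV f" and fy: "f y \<noteq> 0"
    using exists_continuous_real_functional[OF y] by blast
  have dualI: "a \<in> topological_dual scale"
    if "\<And>x z. a (x + z) = a x + a z" "\<And>c x. a (scale c x) = c * a x" "continuous_on UNIV a" for a
  proof -
    have "Vector_Spaces.linear scale (*) a"
      using that by (intro Vector_Spaces.linear.intro module_hom.intro module_hom_axioms.intro
          vector_space_axioms) (unfold_locales, auto simp: algebra_simps)
    then show ?thesis using that by (simp add: topological_dual_def)
  qed
  consider "\<forall>c::'k. \<exists>r. c = of_real r" |
    i where "i * i = - 1" "kconj i = - i" "\<forall>c::'k. \<exists>a b. c = of_real a + i * of_real b"
    using real_or_complex_cases by blast
  then show ?thesis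
  proof cases
    case 1
    have "(\<lambda>x. of_real (f x) :: 'k) \<in> topological_dual scale"
    proof (rule dualI)
      fix c :: 'k and x
      obtain r where "c = of_real r" using 1 by blast
      then show "(of_real (f (scale c x)) :: 'k) = c * of_real (f x)" by (simp add: hom)
    qed (use cont in \<open>auto simp: add intro: continuous_intros\<close>)
    then show ?thesis using fy by (intro bexI) auto
  next
    case (2 i)
    define a where "a x = of_real (f x) - i * of_real (f (scale i x))" for x
    have a_add: "a (x + z) = a x + a z" for x z
      by (simp add: a_def add scale_right_distrib algebra_simps)
    have a_real: "a (scale (of_real r) x) = of_real r * a x" for r x
    proof -
      have "scale i (scale (of_real r) x) = scale (of_real r) (scale i x)"
        by (rule scale_left_commute)
      then show ?thesis unfolding a_def hom by (simp only: hom) (simp add: algebra_simps)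
    qed
    have a_i: "a (scale i x) = i * a x" for x
    proof -
      have "scale i (scale i x) = scale (of_real (- 1)) x" by (simp add: 2(1))
      then have "f (scale i (scale i x)) = - f x" by (simp only: hom)
      then have "a (scale i x) = of_real (f (scale i x)) + i * of_real (f x)"
        by (simp add: a_def)
      also have "\<dots> = i * of_real (f x) - (i * i) * of_real (f (scale i x))"
        unfolding 2(1) by simp
      also have "\<dots> = i * a x" by (simp add: a_def algebra_simps)
      finally show ?thesis .
    qed
    have "a \<in> topological_dual scale"
    proof (rule dualI)
      fix c :: 'k and x
      obtain u v where c: "c = of_real u + i * of_real v" using 2(3) by blast
      have "scale c x = scale (of_real u) x + scale i (scale (of_real v) x)"
        by (simp add: c scale_left_distrib)
      then show "a (scale c x) = c * a x"
        by (simp only: a_add a_i a_real) (simp add: c algebra_simps)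
    next
      have "continuous_on UNIV (scale i)"
        using open_scale_vimage[of _ i 0]
        by (auto simp: continuous_on_open_vimage vimage_def)
      then have "continuous_on UNIV (\<lambda>x. f (scale i x))"
        by (intro continuous_on_compose2[OF cont]) auto
      then show "continuous_on UNIV a"
        unfolding a_def[abs_def] using cont by (intro continuous_intros)
    qed (rule a_add)
    moreover have "a y \<noteq> 0"
    proof
      assume "a y = 0"
      then have eq: "of_real (f y) = i * of_real (f (scale i y))" by (simp add: a_def)
      \<comment> \<open>A real scalar equal to a purely imaginary one vanishes.\<close>
      from arg_cong[OF this, of kconj] have "of_real (f y) = - (i * of_real (f (scale i y)))"
        by (simp add: kconj_of_real kconj_mult 2(2))
      with eq have "(of_real (f y) :: 'k) = - of_real (f y)" by simp
      then have "(of_real (2 * f y) :: 'k) = 0" by (simp add: eq_neg_iff_add_eq_0)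
      then show False using fy by (simp del: of_real_mult)
    qed
    ultimately show ?thesis by blast
  qed
qed

end

text \<open>
  One functional suffices for all sequences: normalize a functional that does not vanish at the unit,
  and pair it with multiples of the unit. Without nonzero functionals every column would be zero, and
  the kernel on triples could not recover the space \<open>G\<close>.
\<close>

lemma (in topological_algebra_with_involutions) pairing_column_surj:
  "\<exists>a \<in> topological_dual scale. \<exists>A. pairing_column star a A = x"
proof -
  obtain a where a: "a \<in> topological_dual scale" "a 1 \<noteq> 0"
    using topological_dual_separates[of 1] by auto
  then interpret a: Vector_Spaces.linear scale "(*)" a by (simp add: topological_dual_def)
  have "pairing_column star a (\<lambda>n. star (scale (x n / a 1) 1)) = x"
    using a(2) by (simp add: pairing_column_def star_star a.scale)
  with a(1) show ?thesis by blast
qed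

section \<open>Reproducing kernel Hilbert spaces of feature maps\<close>

text \<open>
  A kernel is given as the Gram kernel of a family of vectors \<open>\<phi> x\<close> with dense span. The order of the
  arguments in \<open>kernel_eq\<close> matches the convention that \<open>\<lambda>x. k x y\<close> reproduces the value at \<open>y\<close>.
\<close>

locale feature_map = hilbert_space_on scale G ipG
  for scale :: "'k::real_or_complex \<Rightarrow> 'g::ab_group_add \<Rightarrow> 'g" and G ipG +
  fixes X :: "'x set" and \<phi> :: "'x \<Rightarrow> 'g" and k :: "'x \<Rightarrow> 'x \<Rightarrow> 'k"
  assumes feature_in: "x \<in> X \<Longrightarrow> \<phi> x \<in> G"
    and kernel_eq: "\<lbrakk>x \<in> X; y \<in> X\<rbrakk> \<Longrightarrow> k x y = ipG (\<phi> y) (\<phi> x)"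
    and features_total: "dense_on G ipG (span (\<phi> ` X))"
begin

definition feature_function :: "'g \<Rightarrow> 'x \<Rightarrow> 'k" where
  "feature_function f x = (if x \<in> X then ipG f (\<phi> x) else 0)"

lemma feature_function_add:
  "\<lbrakk>f \<in> G; g \<in> G\<rbrakk> \<Longrightarrow> feature_function (f + g) = feature_function f + feature_function g"
  by (simp add: fun_eq_iff feature_function_def feature_in ip_add_left)

lemma feature_function_diff:
  "\<lbrakk>f \<in> G; g \<in> G\<rbrakk> \<Longrightarrow> feature_function (f - g) = feature_function f - feature_function g"
  by (simp add: fun_eq_iff feature_function_def feature_in ip_diff_left)

lemma feature_function_scale:
  "f \<in> G \<Longrightarrow> feature_function (scale c f) = fun_scale c (feature_function f)"
  by (simp add: fun_eq_iff feature_function_def feature_in ip_scale_left fun_scale_def)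

lemma feature_function_zero: "feature_function 0 = 0"
  by (simp add: fun_eq_iff feature_function_def feature_in)

lemma kernel_section:
  "y \<in> X \<Longrightarrow> (\<lambda>x. if x \<in> X then k x y else 0) = feature_function (\<phi> y)"
  by (simp add: fun_eq_iff feature_function_def kernel_eq)

lemma span_features_subset: "span (\<phi> ` X) \<subseteq> G"
  using feature_in subspace_H by (intro span_minimal) auto

text \<open>
  A vector with zero feature function is orthogonal to the dense span of the features.
\<close>

lemma feature_function_inj: "inj_on feature_function G"
proof (rule inj_onI)
  fix f g assume fg: "f \<in> G" "g \<in> G" and eq: "feature_function f = feature_function g"
  define S where "S = {d \<in> G. ipG (f - g) d = 0}"
  have "\<phi> ` X \<subseteq> S"
  proof clarify
    fix x assume x: "x \<in> X"
    have "ipG f (\<phi> x) = ipG g (\<phi> x)"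
      using fun_cong[OF eq, of x] x by (simp add: feature_function_def)
    then show "\<phi> x \<in> S" using fg x by (simp add: S_def feature_in ip_diff_left)
  qed
  moreover have "subspace S"
    using fg by (intro subspaceI) (auto simp: S_def H_closed ip_add_right ip_scale_right)
  ultimately have "span (\<phi> ` X) \<subseteq> S" by (rule span_minimal)
  then have "f - g = 0"
    using fg by (intro orthogonal_dense_imp_zero[OF _ features_total]) (auto simp: S_def H_closed)
  then show "f = g" by simp
qed

text \<open>
  By injectivity the inner product of \<open>G\<close> can be carried over to the feature functions.
\<close>

theorem rkhs_exists: "\<exists>H ip. is_rkhs X k H ip"
proof -
  let ?E = feature_function
  define J where "J = inv_into G ?E"
  define ip where "ip F F' = ipG (J F) (J F')" for F F'
  have J: "J (?E f) = f" if "f \<in> G" for f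
    unfolding J_def using feature_function_inj that by (rule inv_into_f_f)
  have ip: "ip (?E f) (?E g) = ipG f g" if "f \<in> G" "g \<in> G" for f g
    using that by (simp add: ip_def J)
  have nrm: "ip_norm ip (?E f) = ip_norm ipG f" if "f \<in> G" for f
    using that by (simp add: ip_norm_def ip)
  interpret F: vector_space "fun_scale :: 'k \<Rightarrow> ('x \<Rightarrow> 'k) \<Rightarrow> 'x \<Rightarrow> 'k"
    by (rule vector_space_fun_scale)
  have "inner_product_space_on fun_scale (?E ` G) ip"
  proof
    show "F.subspace (?E ` G)"
    proof (rule F.subspaceI)
      show "0 \<in> ?E ` G" using feature_function_zero H_closed(1) by (metis imageI)
    next
      fix F F' assume "F \<in> ?E ` G" "F' \<in> ?E ` G"
      then obtain f f' where f: "f \<in> G" "f' \<in> G" "F = ?E f" "F' = ?E f'" by blast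
      then have "F + F' = ?E (f + f')" by (metis feature_function_add)
      then show "F + F' \<in> ?E ` G" using H_closed(2)[OF f(1,2)] by blast
    next
      fix c F assume "F \<in> ?E ` G"
      then obtain f where f: "f \<in> G" "F = ?E f" by blast
      then have "fun_scale c F = ?E (scale c f)" by (metis feature_function_scale)
      then show "fun_scale c F \<in> ?E ` G" using H_closed(4)[OF f(1)] by blast
    qed
  next
    fix F F' F'' :: "'x \<Rightarrow> 'k" and c :: 'k
    { assume "F \<in> ?E ` G" "F' \<in> ?E ` G" "F'' \<in> ?E ` G"
      then obtain f f' f'' where f: "f \<in> G" "f' \<in> G" "f'' \<in> G"
        and F: "F = ?E f" "F' = ?E f'" "F'' = ?E f''" by blast
      have "ip (F + F') F'' = ipG (f + f') f''"
        unfolding F feature_function_add[OF f(1,2), symmetric] by (rule ip[OF H_closed(2)[OF f(1,2)] f(3)])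
      also have "\<dots> = ip F F'' + ip F' F''"
        unfolding F ip[OF f(1,3)] ip[OF f(2,3)] by (rule ip_add_left[OF f])
      finally show "ip (F + F') F'' = ip F F'' + ip F' F''" . }
    { assume "F \<in> ?E ` G" "F' \<in> ?E ` G"
      then obtain f f' where f: "f \<in> G" "f' \<in> G" "F = ?E f" "F' = ?E f'" by blast
      have "ip (fun_scale c F) F' = ipG (scale c f) f'"
        unfolding f(3,4) feature_function_scale[OF f(1), symmetric]
        by (rule ip[OF H_closed(4)[OF f(1)] f(2)])
      also have "\<dots> = c * ip F F'"
        unfolding f(3,4) ip[OF f(1,2)] by (rule ip_scale_left[OF f(1,2)])
      finally show "ip (fun_scale c F) F' = c * ip F F'" .
      show "ip F' F = kconj (ip F F')"
        unfolding f(3,4) ip[OF f(1,2)] ip[OF f(2,1)] by (rule ip_hermitian[OF f(1,2)]) }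
    assume "F \<in> ?E ` G"
    then obtain f where f: "f \<in> G" "F = ?E f" by blast
    then show "\<exists>r\<ge>0. ip F F = of_real r" by (simp add: ip ip_nonneg)
    assume "ip F F = 0"
    then have "f = 0" using f by (simp add: ip ip_definite)
    then show "F = 0" using f(2) feature_function_zero by simp
  qed
  then interpret I: inner_product_space_on fun_scale "?E ` G" ip .
  have "hilbert_space_on fun_scale (?E ` G) ip"
  proof
    fix Y :: "nat \<Rightarrow> 'x \<Rightarrow> 'k"
    assume Y: "\<And>n. Y n \<in> ?E ` G"
      and Cauchy: "\<And>e. 0 < e \<Longrightarrow> \<exists>N. \<forall>m\<ge>N. \<forall>n\<ge>N. ip_norm ip (Y m - Y n) < e"
    from Y have "\<forall>n. \<exists>f\<in>G. Y n = ?E f" by blast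
    then obtain y where y: "\<And>n. y n \<in> G" "\<And>n. Y n = ?E (y n)" by metis
    have dist: "ip_norm ip (Y n - ?E f) = ip_norm ipG (y n - f)" if "f \<in> G" for n f
      using nrm[OF H_closed(3)[OF y(1) that]] feature_function_diff[OF y(1) that] y(2) by metis
    have "\<exists>L\<in>G. (\<lambda>n. ip_norm ipG (y n - L)) \<longlonglongrightarrow> 0"
    proof (rule complete_H)
      fix e :: real assume "0 < e"
      from Cauchy[OF this] show "\<exists>N. \<forall>m\<ge>N. \<forall>n\<ge>N. ip_norm ipG (y m - y n) < e"
        using dist[OF y(1)] y(2) by metis
    qed (rule y(1))
    then obtain L where "L \<in> G" "(\<lambda>n. ip_norm ipG (y n - L)) \<longlonglongrightarrow> 0" by blast
    then show "\<exists>L\<in>?E ` G. (\<lambda>n. ip_norm ip (Y n - L)) \<longlonglongrightarrow> 0"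
      by (intro bexI[of _ "?E L"]) (simp_all add: dist)
  qed
  moreover have "F x = 0" if "F \<in> ?E ` G" "x \<notin> X" for F x
    using that by (auto simp: feature_function_def)
  moreover have "F y = ip F (?E (\<phi> y))" if F: "F \<in> ?E ` G" and y: "y \<in> X" for F y
  proof -
    obtain f where f: "f \<in> G" "F = ?E f" using F by blast
    then show ?thesis
      using y ip[OF f(1) feature_in[OF y]] by (simp add: feature_function_def)
  qed
  ultimately have "is_rkhs X k (?E ` G) ip"
    unfolding is_rkhs_def by (simp add: kernel_section feature_in)
  then show ?thesis by blast
qed

text \<open>
  On the span of the features, \<open>feature_function\<close> maps into \<open>H\<close> and is isometric, both by the reproducing
  property. A vector \<open>f\<close> of \<open>G\<close> is a limit of such combinations; their images form a Cauchy sequence in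
  \<open>H\<close>, whose limit is the feature function of \<open>f\<close>, because evaluation at a point is continuous on both
  sides. Hence all of \<open>G\<close> embeds isometrically. For surjectivity, given \<open>F\<close> in \<open>H\<close>, represent the
  functional \<open>g \<mapsto> \<langle>feature_function g, F\<rangle>\<close> on \<open>G\<close> by a vector \<open>h\<close>; testing with \<open>g = \<phi> x\<close> shows that
  \<open>F\<close> is the feature function of \<open>h\<close>.
\<close>

theorem rkhs_unique:
  assumes rkhs: "is_rkhs X k H ip"
  shows "H = feature_function ` G"
    and "\<lbrakk>f \<in> G; g \<in> G\<rbrakk> \<Longrightarrow> ip (feature_function f) (feature_function g) = ipG f g"
proof -
  let ?E = feature_function
  let ?S = "span (\<phi> ` X)"
  interpret H: hilbert_space_on fun_scale H ip
    using rkhs by (simp add: is_rkhs_def)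
  have vanish: "F x = 0" if "F \<in> H" "x \<notin> X" for F x
    using rkhs that by (simp add: is_rkhs_def)
  have section_H: "?E (\<phi> y) \<in> H" if "y \<in> X" for y
    using rkhs that kernel_section[OF that] unfolding is_rkhs_def by metis
  have reproducing: "F y = ip F (?E (\<phi> y))" if "F \<in> H" "y \<in> X" for F y
    using rkhs that kernel_section[OF that(2)] unfolding is_rkhs_def by metis
  have SG: "f \<in> G" if "f \<in> ?S" for f using that span_features_subset by blast
  have S_H: "?E f \<in> H" if "f \<in> ?S" for f
  proof -
    have "subspace {f \<in> G. ?E f \<in> H}"
    proof (rule subspaceI)
      show "0 \<in> {f \<in> G. ?E f \<in> H}"
        using H_closed(1) H.H_closed(1) feature_function_zero by (metis (mono_tags) mem_Collect_eq)
    next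
      fix f g assume fg: "f \<in> {f \<in> G. ?E f \<in> H}" "g \<in> {f \<in> G. ?E f \<in> H}"
      then have "?E (f + g) \<in> H"
        using H.H_closed(2) feature_function_add by (metis (mono_tags, lifting) mem_Collect_eq)
      then show "f + g \<in> {f \<in> G. ?E f \<in> H}" using fg H_closed by simp
    next
      fix c f assume f: "f \<in> {f \<in> G. ?E f \<in> H}"
      then have "?E (scale c f) \<in> H"
        using H.H_closed(4) feature_function_scale by (metis (mono_tags, lifting) mem_Collect_eq)
      then show "scale c f \<in> {f \<in> G. ?E f \<in> H}" using f H_closed by simp
    qed
    moreover have "\<phi> ` X \<subseteq> {f \<in> G. ?E f \<in> H}" using section_H feature_in by blast
    ultimately have "?S \<subseteq> {f \<in> G. ?E f \<in> H}" by (intro span_minimal)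
    then show ?thesis using that by blast
  qed
  \<comment> \<open>Membership in the span is carried along because the induction rule does not supply it.\<close>
  have "g \<in> ?S \<and> ip (?E f) (?E g) = ipG f g" if f: "f \<in> ?S" and g: "g \<in> ?S" for f g
    using g
  proof (induction rule: span_induct_alt)
    case base
    show ?case
      using H.ip_zero_right[OF S_H[OF f]] ip_zero_right[OF SG[OF f]]
      by (metis feature_function_zero span_zero)
  next
    case (step c x g)
    then obtain y where y: "y \<in> X" "x = \<phi> y" by blast
    from step have gS: "g \<in> ?S" and IH: "ip (?E f) (?E g) = ipG f g" by blast+
    have "ip (?E f) (?E x) = ipG f x"
      using reproducing[OF S_H[OF f] y(1)] y by (simp add: feature_function_def)
    moreover have xG: "x \<in> G" and xH: "?E x \<in> H" using y feature_in section_H by auto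
    moreover have "?E (scale c x + g) = fun_scale c (?E x) + ?E g"
      using feature_function_add[OF H_closed(4)[OF xG] SG[OF gS]] feature_function_scale[OF xG] by metis
    ultimately have "ip (?E f) (?E (scale c x + g)) = kconj c * ipG f x + ipG f g"
      using H.ip_add_right[OF H.H_closed(4)[OF xH] S_H[OF gS] S_H[OF f]]
        H.ip_scale_right[OF xH S_H[OF f]] IH by metis
    also have "\<dots> = ipG f (scale c x + g)"
      using ip_add_right[OF H_closed(4)[OF xG] SG[OF gS] SG[OF f]] ip_scale_right[OF xG SG[OF f]] by metis
    finally show ?case
      using span_add[OF span_scale[OF span_base[OF step(1)]] gS] by blast
  qed
  then have S_ip: "ip (?E f) (?E g) = ipG f g" if "f \<in> ?S" "g \<in> ?S" for f g
    using that by blast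
  have dist: "ip_norm ip (?E f - ?E g) = ip_norm ipG (f - g)" if "f \<in> ?S" "g \<in> ?S" for f g
    using S_ip[OF span_diff[OF that] span_diff[OF that]]
      feature_function_diff[OF SG[OF that(1)] SG[OF that(2)]] by (simp add: ip_norm_def)
  have approx: "\<exists>Y. (\<forall>n. Y n \<in> ?S) \<and> (\<lambda>n. ip_norm ipG (Y n - f)) \<longlonglongrightarrow> 0 \<and>
      ?E f \<in> H \<and> (\<lambda>n. ip_norm ip (?E (Y n) - ?E f)) \<longlonglongrightarrow> 0" if f: "f \<in> G" for f
  proof -
    have "\<exists>s\<in>?S. ip_norm ipG (f - s) < inverse (real (Suc n))" for n
      using features_total f unfolding dense_on_def
      by (meson inverse_positive_iff_positive of_nat_0_less_iff zero_less_Suc)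
    then obtain Y where Y: "\<And>n. Y n \<in> ?S" and le: "\<And>n. ip_norm ipG (f - Y n) < inverse (real (Suc n))"
      by metis
    have YG: "Y n \<in> G" for n using Y SG by blast
    have Yf: "(\<lambda>n. ip_norm ipG (Y n - f)) \<longlonglongrightarrow> 0"
    proof (rule Lim_null_comparison[OF always_eventually LIMSEQ_inverse_real_of_nat], rule allI)
      show "norm (ip_norm ipG (Y n - f)) \<le> inverse (real (Suc n))" for n
        using le[of n] ip_norm_minus_commute[OF f YG[of n]] by simp
    qed
    have "\<exists>L\<in>H. (\<lambda>n. ip_norm ip (?E (Y n) - L)) \<longlonglongrightarrow> 0"
    proof (rule H.complete_H)
      show "?E (Y n) \<in> H" for n using Y S_H by blast
      fix e :: real assume e: "0 < e"
      then have "\<forall>\<^sub>F n in sequentially. ip_norm ipG (Y n - f) < e / 2"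
        using Yf by (intro order_tendstoD) auto
      then obtain N where N: "\<And>n. N \<le> n \<Longrightarrow> ip_norm ipG (Y n - f) < e / 2"
        unfolding eventually_sequentially by blast
      have "ip_norm ip (?E (Y m) - ?E (Y n)) < e" if "N \<le> m" "N \<le> n" for m n
        using ip_norm_triangle_diff[OF YG f YG, of m n] N[OF that(1)] N[OF that(2)]
          ip_norm_minus_commute[OF f YG[of n]] dist[OF Y Y, of m n] by linarith
      then show "\<exists>N. \<forall>m\<ge>N. \<forall>n\<ge>N. ip_norm ip (?E (Y m) - ?E (Y n)) < e" by blast
    qed
    then obtain L where L: "L \<in> H" and YL: "(\<lambda>n. ip_norm ip (?E (Y n) - L)) \<longlonglongrightarrow> 0" by blast
    have "L x = ?E f x" for x
    proof (cases "x \<in> X")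
      case True
      have const: "(\<lambda>n. ip_norm ip (?E (\<phi> x) - ?E (\<phi> x))) \<longlonglongrightarrow> 0"
        "(\<lambda>n. ip_norm ipG (\<phi> x - \<phi> x)) \<longlonglongrightarrow> 0"
        using H.ip_norm_eq_0[OF H.H_closed(1)] ip_norm_eq_0[OF H_closed(1)] by simp_all
      have "(\<lambda>n. ip (?E (Y n)) (?E (\<phi> x))) \<longlonglongrightarrow> ip L (?E (\<phi> x))"
        using S_H[OF Y] L YL section_H[OF True] section_H[OF True] const(1) by (rule H.ip_tendsto)
      moreover have "ip (?E (Y n)) (?E (\<phi> x)) = ipG (Y n) (\<phi> x)" for n
        using reproducing[OF S_H[OF Y] True, of n] True by (simp add: feature_function_def)
      moreover have "(\<lambda>n. ipG (Y n) (\<phi> x)) \<longlonglongrightarrow> ipG f (\<phi> x)"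
        using YG f Yf feature_in[OF True] feature_in[OF True] const(2) by (rule ip_tendsto)
      ultimately have "ip L (?E (\<phi> x)) = ipG f (\<phi> x)"
        using LIMSEQ_unique by simp
      then show ?thesis using reproducing[OF L True] True by (simp add: feature_function_def)
    next
      case False
      then show ?thesis using vanish[OF L False] by (simp add: feature_function_def)
    qed
    then have "L = ?E f" by (rule ext)
    with Y Yf L YL show ?thesis by blast
  qed
  have G_H: "?E f \<in> H" if "f \<in> G" for f using approx[OF that] by blast
  show isometry: "ip (?E f) (?E g) = ipG f g" if f: "f \<in> G" and g: "g \<in> G" for f g
  proof -
    obtain Y where Y: "\<And>n. Y n \<in> ?S" "(\<lambda>n. ip_norm ipG (Y n - f)) \<longlonglongrightarrow> 0"
      "(\<lambda>n. ip_norm ip (?E (Y n) - ?E f)) \<longlonglongrightarrow> 0" using approx[OF f] by blast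
    obtain Z where Z: "\<And>n. Z n \<in> ?S" "(\<lambda>n. ip_norm ipG (Z n - g)) \<longlonglongrightarrow> 0"
      "(\<lambda>n. ip_norm ip (?E (Z n) - ?E g)) \<longlonglongrightarrow> 0" using approx[OF g] by blast
    have "(\<lambda>n. ip (?E (Y n)) (?E (Z n))) \<longlonglongrightarrow> ip (?E f) (?E g)"
      using S_H[OF Y(1)] G_H[OF f] Y(3) S_H[OF Z(1)] G_H[OF g] Z(3) by (rule H.ip_tendsto)
    moreover have "(\<lambda>n. ipG (Y n) (Z n)) \<longlonglongrightarrow> ipG f g"
      using SG[OF Y(1)] f Y(2) SG[OF Z(1)] g Z(2) by (rule ip_tendsto)
    ultimately show ?thesis
      using LIMSEQ_unique by (simp add: S_ip[OF Y(1) Z(1)])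
  qed
  show "H = ?E ` G"
  proof (intro subset_antisym subsetI)
    fix F assume F: "F \<in> H"
    have "\<exists>h\<in>G. \<forall>g\<in>G. ip (?E g) F = ipG g h"
    proof (rule Riesz_representation)
      fix g assume g: "g \<in> G"
      show "norm (ip (?E g) F) \<le> ip_norm ip F * ip_norm ipG g"
        using H.Cauchy_Schwarz[OF G_H[OF g] F] isometry[OF g g] by (simp add: ip_norm_def mult.commute)
      show "ip (?E (scale c g)) F = c * ip (?E g) F" for c
        unfolding feature_function_scale[OF g] by (rule H.ip_scale_left[OF G_H[OF g] F])
      show "ip (?E (g + g')) F = ip (?E g) F + ip (?E g') F" if "g' \<in> G" for g'
        unfolding feature_function_add[OF g that] by (rule H.ip_add_left[OF G_H[OF g] G_H[OF that] F])
    qed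
    then obtain h where h: "h \<in> G" "\<And>g. g \<in> G \<Longrightarrow> ip (?E g) F = ipG g h" by blast
    have "F x = ?E h x" for x
    proof (cases "x \<in> X")
      case True
      have "F x = kconj (ip (?E (\<phi> x)) F)"
        using reproducing[OF F True] H.ip_hermitian[OF section_H[OF True] F] by simp
      also have "\<dots> = ipG h (\<phi> x)"
        using h(2)[OF feature_in[OF True]] ip_hermitian[OF feature_in[OF True] h(1)] by simp
      finally show ?thesis using True by (simp add: feature_function_def)
    next
      case False
      then show ?thesis using vanish[OF F False] by (simp add: feature_function_def)
    qed
    then have "F = ?E h" by (rule ext)
    with h(1) show "F \<in> ?E ` G" by blast
  next
    fix F assume "F \<in> ?E ` G"
    then show "F \<in> H" using G_H by blast
  qed
qed

end

section \<open>The kernel on triples\<close>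

lemma pd_kernel_comp:
  assumes k: "pd_kernel Y k" and h: "\<And>x. x \<in> X \<Longrightarrow> h x \<in> Y"
    and eq: "\<And>x y. \<lbrakk>x \<in> X; y \<in> X\<rbrakk> \<Longrightarrow> k' x y = k (h x) (h y)"
  shows "pd_kernel X k'"
  unfolding pd_kernel_def
proof (intro conjI ballI allI impI)
  fix x y assume "x \<in> X" "y \<in> X"
  then show "k' y x = kconj (k' x y)"
    using k h eq unfolding pd_kernel_def by metis
next
  fix N :: nat and x c assume x: "\<forall>i<N. x i \<in> X"
  have "(\<Sum>i<N. \<Sum>j<N. kconj (c i) * k' (x i) (x j) * c j)
      = (\<Sum>i<N. \<Sum>j<N. kconj (c i) * k (h (x i)) (h (x j)) * c j)"
    using x by (intro sum.cong refl) (simp add: eq)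
  moreover have "\<exists>r\<ge>0. (\<Sum>i<N. \<Sum>j<N. kconj (c i) * k (h (x i)) (h (x j)) * c j) = of_real r"
    using k[unfolded pd_kernel_def, THEN conjunct2, rule_format, of N "\<lambda>i. h (x i)" c] x h by blast
  ultimately show "\<exists>r\<ge>0. (\<Sum>i<N. \<Sum>j<N. kconj (c i) * k' (x i) (x j) * c j) = of_real r"
    by simp
qed

lemma triple_kernel_eq:
  assumes "ell2_bounded_operator (K z w)"
    and "pairing_column star a A \<in> ell2" "pairing_column star b B \<in> ell2"
  shows "double_summable (triple_kernel_term K star (z, A, a) (w, B, b))"
    and "triple_kernel K star (z, A, a) (w, B, b)
      = ell2_ip (K z w (pairing_column star b B)) (pairing_column star a A)"
proof -
  have "triple_kernel_term K star (z, A, a) (w, B, b) = (\<lambda>n m.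
      kconj (pairing_column star a A n) * matrix_entry (K z w) n m * pairing_column star b B m)"
    by (simp add: triple_kernel_term_def pairing_column_def)
  then have lim: "(double_partial_sum (triple_kernel_term K star (z, A, a) (w, B, b))
      \<longlongrightarrow> ell2_ip (K z w (pairing_column star b B)) (pairing_column star a A))
      (sequentially \<times>\<^sub>F sequentially)"
    using double_partial_sum_tendsto[OF assms] by simp
  then show "double_summable (triple_kernel_term K star (z, A, a) (w, B, b))"
    unfolding double_summable_def by blast
  show "triple_kernel K star (z, A, a) (w, B, b)
      = ell2_ip (K z w (pairing_column star b B)) (pairing_column star a A)"
    unfolding triple_kernel_def double_suminf_def
    by (rule tendsto_Lim[OF _ lim]) (simp add: prod_filter_eq_bot)
qed

theorem proposition2p2:
  fixes \<Omega>\<^sub>K :: "'k::real_or_complex set"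
    and K :: "'k \<Rightarrow> 'k \<Rightarrow> (nat \<Rightarrow> 'k) \<Rightarrow> nat \<Rightarrow> 'k"
    and scaleG :: "'k \<Rightarrow> 'g::ab_group_add \<Rightarrow> 'g"
    and G :: "'g set"
    and ipG :: "'g \<Rightarrow> 'g \<Rightarrow> 'k"
    and \<Gamma> :: "'k \<Rightarrow> 'g \<Rightarrow> nat \<Rightarrow> 'k"
    and scaleA :: "'k \<Rightarrow> 'a::{ring_1, topological_ab_group_add, t2_space} \<Rightarrow> 'a"
    and star :: "'a \<Rightarrow> 'a"
    and dual_star :: "('a \<Rightarrow> 'k) \<Rightarrow> 'a \<Rightarrow> 'k"
    and \<Omega> :: "('k \<times> (nat \<Rightarrow> 'a) \<times> ('a \<Rightarrow> 'k)) set"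
  assumes "pd_operator_kernel \<Omega>\<^sub>K K"
    and "minimal_factorization \<Omega>\<^sub>K K scaleG G ipG \<Gamma>"
    and "topological_algebra_with_involutions scaleA star dual_star"
    and "\<Omega> = triples \<Omega>\<^sub>K scaleA star"
  shows
    "(\<forall>z A a w B b. (z, A, a) \<in> \<Omega> \<longrightarrow> (w, B, b) \<in> \<Omega> \<longrightarrow>
        ell2_ip (K z w (pairing_column star b B)) (pairing_column star a A)
        = ipG (adjoint_on G ipG ell2_ip (\<Gamma> w) (pairing_column star b B))
              (adjoint_on G ipG ell2_ip (\<Gamma> z) (pairing_column star a A)))
     \<and> (\<forall>p\<in>\<Omega>. \<forall>q\<in>\<Omega>. double_summable (triple_kernel_term K star p q))
     \<and> pd_kernel \<Omega> (triple_kernel K star)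
     \<and> (\<exists>H ip. is_rkhs \<Omega> (triple_kernel K star) H ip)
     \<and> (\<forall>H ip. is_rkhs \<Omega> (triple_kernel K star) H ip \<longrightarrow>
          H = factor_function \<Omega> star G ipG \<Gamma> ` G \<and>
          (\<forall>f\<in>G. \<forall>g\<in>G.
             ip (factor_function \<Omega> star G ipG \<Gamma> f) (factor_function \<Omega> star G ipG \<Gamma> g) = ipG f g) \<and>
          (\<forall>f\<in>G. ip_norm ip (factor_function \<Omega> star G ipG \<Gamma> f) = ip_norm ipG f))"
proof -
  interpret A: topological_algebra_with_involutions scaleA star dual_star by fact
  let ?adj = "\<lambda>z. adjoint_on G ipG ell2_ip (\<Gamma> z)"
  define \<phi> where "\<phi> = (\<lambda>(z, A, a). ?adj z (pairing_column star a A))"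
  have hilbert: "hilbert_space_on scaleG G ipG"
    and \<Gamma>: "\<And>z. z \<in> \<Omega>\<^sub>K \<Longrightarrow> bounded_operator_on scaleG G ipG fun_scale ell2 ell2_ip (\<Gamma> z)"
    and fact: "\<And>z w x. \<lbrakk>z \<in> \<Omega>\<^sub>K; w \<in> \<Omega>\<^sub>K; x \<in> ell2\<rbrakk> \<Longrightarrow> K z w x = \<Gamma> z (?adj w x)"
    and dense: "dense_on G ipG (module.span scaleG (\<Union>w\<in>\<Omega>\<^sub>K. ?adj w ` ell2))"
    using assms(2) unfolding minimal_factorization_def by blast+
  have K: "\<And>z w. \<lbrakk>z \<in> \<Omega>\<^sub>K; w \<in> \<Omega>\<^sub>K\<rbrakk> \<Longrightarrow> ell2_bounded_operator (K z w)"
    and pd: "pd_kernel (\<Omega>\<^sub>K \<times> ell2) (\<lambda>(z, f) (w, e). ell2_ip (K z w e) f)"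
    using assms(1) unfolding pd_operator_kernel_def by blast+
  note adj = adjoint_on[OF hilbert ell2.inner_product_space_on_axioms \<Gamma>]
  have \<Omega>: "z \<in> \<Omega>\<^sub>K" "pairing_column star a A \<in> ell2" if "(z, A, a) \<in> \<Omega>" for z A a
    using that assms(4) by (simp_all add: triples_def)
  have factorization: "ell2_ip (K z w (pairing_column star b B)) (pairing_column star a A)
      = ipG (?adj w (pairing_column star b B)) (?adj z (pairing_column star a A))"
    if p: "(z, A, a) \<in> \<Omega>" and q: "(w, B, b) \<in> \<Omega>" for z A a w B b
    unfolding fact[OF \<Omega>(1)[OF p] \<Omega>[OF q]]
    by (rule adj(2)[OF \<Omega>[OF p] adj(1)[OF \<Omega>[OF q]]])
  have kernel: "triple_kernel K star p q = (\<lambda>(z, f) (w, e). ell2_ip (K z w e) f)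
      ((\<lambda>(z, A, a). (z, pairing_column star a A)) p) ((\<lambda>(z, A, a). (z, pairing_column star a A)) q)"
    and summable: "double_summable (triple_kernel_term K star p q)"
    if "p \<in> \<Omega>" "q \<in> \<Omega>" for p q
  proof -
    obtain z A a w B b where pq: "p = (z, A, a)" "q = (w, B, b)" by (metis prod_cases3)
    note p = \<Omega>[OF that(1)[unfolded pq]] and q = \<Omega>[OF that(2)[unfolded pq]]
    show "double_summable (triple_kernel_term K star p q)"
      unfolding pq by (rule triple_kernel_eq(1)) (fact K[OF p(1) q(1)] p(2) q(2))+
    show "triple_kernel K star p q = (\<lambda>(z, f) (w, e). ell2_ip (K z w e) f)
        ((\<lambda>(z, A, a). (z, pairing_column star a A)) p)
        ((\<lambda>(z, A, a). (z, pairing_column star a A)) q)"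
      unfolding pq prod.case by (rule triple_kernel_eq(2)) (fact K[OF p(1) q(1)] p(2) q(2))+
  qed
  have pd_triple: "pd_kernel \<Omega> (triple_kernel K star)"
  proof (rule pd_kernel_comp[OF pd _ kernel])
    show "(\<lambda>(z, A, a). (z, pairing_column star a A)) p \<in> \<Omega>\<^sub>K \<times> ell2" if "p \<in> \<Omega>" for p
      using that \<Omega> by (cases p) simp
  qed
  \<comment> \<open>Every vector of \<open>\<ell>\<^sub>2\<close> is a column, so density of the span passes from the ranges to the features.\<close>
  have image: "\<phi> ` \<Omega> = (\<Union>w\<in>\<Omega>\<^sub>K. ?adj w ` ell2)"
  proof (intro subset_antisym subsetI)
    fix g assume "g \<in> \<phi> ` \<Omega>"
    then obtain z A a where p: "(z, A, a) \<in> \<Omega>" "g = \<phi> (z, A, a)" by (metis imageE prod_cases3)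
    then show "g \<in> (\<Union>w\<in>\<Omega>\<^sub>K. ?adj w ` ell2)"
      using \<Omega>[OF p(1)] unfolding \<phi>_def prod.case by blast
  next
    fix g assume "g \<in> (\<Union>w\<in>\<Omega>\<^sub>K. ?adj w ` ell2)"
    then obtain w x where wx: "w \<in> \<Omega>\<^sub>K" "x \<in> ell2" "g = ?adj w x" by blast
    obtain a A where "a \<in> topological_dual scaleA" "pairing_column star a A = x"
      using A.pairing_column_surj by blast
    then have "(w, A, a) \<in> \<Omega>" "\<phi> (w, A, a) = g"
      using wx by (simp_all add: assms(4) triples_def \<phi>_def)
    then show "g \<in> \<phi> ` \<Omega>" by blast
  qed
  interpret F: feature_map scaleG G ipG \<Omega> \<phi> "triple_kernel K star"
  proof (intro feature_map.intro feature_map_axioms.intro hilbert)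
    show "\<phi> p \<in> G" if "p \<in> \<Omega>" for p
      using that adj(1)[OF \<Omega>(1) \<Omega>(2)] unfolding \<phi>_def by (cases p) simp
    show "triple_kernel K star p q = ipG (\<phi> q) (\<phi> p)" if "p \<in> \<Omega>" "q \<in> \<Omega>" for p q
      using kernel[OF that] that factorization unfolding \<phi>_def by (cases p; cases q) simp
    show "dense_on G ipG (module.span scaleG (\<phi> ` \<Omega>))"
      unfolding image by (rule dense)
  qed
  have eq: "factor_function \<Omega> star G ipG \<Gamma> = F.feature_function"
  proof (intro ext)
    show "factor_function \<Omega> star G ipG \<Gamma> f p = F.feature_function f p" for f p
      unfolding F.feature_function_def by (cases p) (simp add: factor_function_def \<phi>_def)
  qed
  show ?thesis
  proof (intro conjI)
    show "\<forall>z A a w B b. (z, A, a) \<in> \<Omega> \<longrightarrow> (w, B, b) \<in> \<Omega> \<longrightarrow>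
        ell2_ip (K z w (pairing_column star b B)) (pairing_column star a A)
        = ipG (?adj w (pairing_column star b B)) (?adj z (pairing_column star a A))"
      using factorization by blast
    show "\<forall>p\<in>\<Omega>. \<forall>q\<in>\<Omega>. double_summable (triple_kernel_term K star p q)"
      using summable by blast
    show "pd_kernel \<Omega> (triple_kernel K star)" by (rule pd_triple)
    show "\<exists>H ip. is_rkhs \<Omega> (triple_kernel K star) H ip" by (rule F.rkhs_exists)
    show "\<forall>H ip. is_rkhs \<Omega> (triple_kernel K star) H ip \<longrightarrow>
          H = factor_function \<Omega> star G ipG \<Gamma> ` G \<and>
          (\<forall>f\<in>G. \<forall>g\<in>G.
             ip (factor_function \<Omega> star G ipG \<Gamma> f) (factor_function \<Omega> star G ipG \<Gamma> g) = ipG f g) \<and>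
          (\<forall>f\<in>G. ip_norm ip (factor_function \<Omega> star G ipG \<Gamma> f) = ip_norm ipG f)"
      unfolding eq ip_norm_def
    proof (intro allI impI)
      fix H ip assume rkhs: "is_rkhs \<Omega> (triple_kernel K star) H ip"
      show "H = F.feature_function ` G \<and>
          (\<forall>f\<in>G. \<forall>g\<in>G. ip (F.feature_function f) (F.feature_function g) = ipG f g) \<and>
          (\<forall>f\<in>G. sqrt (norm (ip (F.feature_function f) (F.feature_function f)))
            = sqrt (norm (ipG f f)))"
        using F.rkhs_unique[OF rkhs] by simp
    qed
  qed
qed

end
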